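(* For any integer $\gamma \geq 0$, the operad $\mathsf{Dias}_\gamma$ admits the following presentation. It is generated by $\mathfrak{G}'_\gamma := \{\bar\dashv_a, \bar\vdash_a : a \in [\gamma]\}$ and its space of relations is generated by the following elements: $$\bar\dashv_a \circ_1 \bar\vdash_{a'} - \bar\vdash_{a'} \circ_2 \bar\dashv_a, \qquad a, a' \in [\gamma];$$ for all $a < b \in [\gamma]$, $$\bar\vdash_b \circ_1 \bar\vdash_a, \qquad \bar\dashv_b \circ_2 \bar\dashv_a, \qquad \bar\vdash_b \circ_1 \bar\dashv_a, \qquad \bar\dashv_b \circ_2 \bar\vdash_a,$$ $$\bar\vdash_a \circ_1 \bar\vdash_b - \bar\vdash_b \circ_2 \bar\vdash_a, \qquad \bar\dashv_b \circ_1 \bar\dashv_a - \bar\dashv_a \circ_2 \bar\dashv_b,$$ $$\bar\vdash_a \circ_1 \bar\dashv_b - \bar\vdash_a \circ_2 \bar\vdash_b, \qquad \bar\dashv_a \circ_1 \bar\dashv_b - \bar\dashv_a \circ_2 \bar\vdash_b;$$ and for all $a \in [\gamma]$, $$\bar\vdash_a \circ_1 \bar\vdash_a - \Big(\sum_{a \leq b \in [\gamma]} \bar\vdash_a \circ_2 \bar\vdash_b\Big), \qquad \Big(\sum_{a \leq b \in [\gamma]} \bar\dashv_a \circ_1 \bar\dashv_b\Big) - \bar\dashv_a \circ_2 \bar\dashv_a,$$ $$\bar\vdash_a \circ_1 \bar\dashv_a - \Big(\sum_{a \leq b \in [\gamma]} \bar\vdash_b \circ_2 \bar\vdash_a\Big),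 \qquad \Big(\sum_{a \leq b \in [\gamma]} \bar\dashv_b \circ_1 \bar\dashv_a\Big) - \bar\dashv_a \circ_2 \bar\vdash_a.$$
   Context: The ground field has characteristic zero; $[\gamma]=\{1,\dots,\gamma\}$. $\mathsf{Dias}_\gamma$ is the nonsymmetric operad in vector spaces generated by the words $0a$, $a0$, $a \in [\gamma]$, inside the operad whose arity-$n$ component ($n\ge1$) has as basis all words of length $n$ on $\{0\}\cup[\gamma]$, with partial compositions $u \circ_i v := u_1 \dots u_{i-1}\,\max(u_i, v_1) \dots \max(u_i, v_m)\, u_{i+1} \dots u_n$ and unit the word $0$. $\mathbf{Free}(S)$ is the free nonsymmetric operad on a graded set $S$ (basis: planar rooted trees with internal nodes of arity $k$ labeled by arity-$k$ elements of $S$; $\mathfrak{s}\circ_i\mathfrak{t}$ grafts $\mathfrak{t}$ on the $i$th leaf of $\mathfrak{s}$); elements of $S$ are identified with trees with one internal node. Let $\mathfrak{G}_\gamma := \{\dashv_a, \vdash_a : a \in [\gamma]\}$, all of arity $2$, where $\dashv_a$ corresponds to the word $0a$ and $\vdash_a$ to the word $a0$. In $\mathbf{Free}(\mathfrak{G}_\gamma)(2)$ define, for $a \in [\gamma]$, $\bar\dashv_a := \dashv_\gamma$ if $a = \gamma$ and $\bar\dashv_a := \dashv_a - \dashv_{a+1}$ otherwise; $\bar\vdash_a := \vdash_\gamma$ if $a = \gamma$ and $\bar\vdash_a := \vdash_a - \vdash_{a+1}$ otherwise. The family $\mathfrak{G}'_\gamma$ of these elements is a basis of $\mathbf{Free}(\mathfrak{G}_\gamma)(2)$,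 so $\mathbf{Free}(\mathfrak{G}'_\gamma)$ is identified with $\mathbf{Free}(\mathfrak{G}_\gamma)$. Saying that an operad $\mathcal{O}$ admits the presentation with generators $\mathfrak{G}$ and space of relations $\mathfrak{R} \subseteq \mathbf{Free}(\mathfrak{G})$ means $\mathcal{O} \cong \mathbf{Free}(\mathfrak{G})/\langle\mathfrak{R}\rangle$, where $\langle\mathfrak{R}\rangle$ is the operad ideal generated by $\mathfrak{R}$. *)

theory Defs
  imports Complex_Main "HOL-Library.Poly_Mapping"
begin

section \<open>Nonsymmetric operads in vector spaces\<close>

text \<open>
  The signature of a nonsymmetric operad over a field: a graded vector space given by carrier
  sets, with the partial compositions and the unit.  The vector space operations carry the arity
  and \<open>pcomp P m n i x y\<close> is \<open>x \<circ>\<^sub>i y\<close> for \<open>x\<close> of arity \<open>m\<close> and \<open>y\<close> of arity \<open>n\<close> (meaningful for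
  \<open>1 \<le> i \<le> m\<close>), because an element of a carrier type need not determine its arity:
  zero vectors are shared by all arities.  The index \<open>0\<close> is allowed only to keep quantifiers
  simple; in the operads below the component of arity \<open>0\<close> is the zero space.
\<close>

record ('k, 'v) ns_operad =
  component :: "nat \<Rightarrow> 'v set"
  vzero :: "nat \<Rightarrow> 'v"
  vadd :: "nat \<Rightarrow> 'v \<Rightarrow> 'v \<Rightarrow> 'v"
  vscale :: "nat \<Rightarrow> 'k \<Rightarrow> 'v \<Rightarrow> 'v"
  pcomp :: "nat \<Rightarrow> nat \<Rightarrow> nat \<Rightarrow> 'v \<Rightarrow> 'v \<Rightarrow> 'v"
  opunit :: 'v

definition graded_subspace :: "('k, 'v) ns_operad \<Rightarrow> (nat \<Rightarrow> 'v set) \<Rightarrow> bool" where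
  "graded_subspace P Q \<longleftrightarrow>
     (\<forall>n. Q n \<subseteq> component P n \<and> vzero P n \<in> Q n \<and>
        (\<forall>x\<in>Q n. \<forall>y\<in>Q n. vadd P n x y \<in> Q n) \<and>
        (\<forall>c. \<forall>x\<in>Q n. vscale P n c x \<in> Q n))"

definition is_suboperad :: "('k, 'v) ns_operad \<Rightarrow> (nat \<Rightarrow> 'v set) \<Rightarrow> bool" where
  "is_suboperad P Q \<longleftrightarrow>
     graded_subspace P Q \<and> opunit P \<in> Q 1 \<and>
     (\<forall>m n i. \<forall>x\<in>Q m. \<forall>y\<in>Q n. i \<in> {1..m} \<longrightarrow> pcomp P m n i x y \<in> Q (m + n - 1))"

definition suboperad_generated ::
  "('k, 'v) ns_operad \<Rightarrow> (nat \<Rightarrow> 'v set) \<Rightarrow> ('k, 'v) ns_operad" where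
  "suboperad_generated P X =
     P\<lparr>component := \<lambda>n. \<Inter>{Q n | Q. is_suboperad P Q \<and> (\<forall>k. X k \<subseteq> Q k)}\<rparr>"

definition is_operad_ideal :: "('k, 'v) ns_operad \<Rightarrow> (nat \<Rightarrow> 'v set) \<Rightarrow> bool" where
  "is_operad_ideal P I \<longleftrightarrow>
     graded_subspace P I \<and>
     (\<forall>m n i. i \<in> {1..m} \<longrightarrow>
        (\<forall>x\<in>I m. \<forall>y\<in>component P n. pcomp P m n i x y \<in> I (m + n - 1)) \<and>
        (\<forall>x\<in>component P m. \<forall>y\<in>I n. pcomp P m n i x y \<in> I (m + n - 1)))"

definition ideal_generated ::
  "('k, 'v) ns_operad \<Rightarrow> (nat \<Rightarrow> 'v set) \<Rightarrow> nat \<Rightarrow> 'v set" where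
  "ideal_generated P R n = \<Inter>{I n | I. is_operad_ideal P I \<and> (\<forall>k. R k \<subseteq> I k)}"

definition vcoset :: "('k, 'v) ns_operad \<Rightarrow> (nat \<Rightarrow> 'v set) \<Rightarrow> nat \<Rightarrow> 'v \<Rightarrow> 'v set" where
  "vcoset P I n x = (\<lambda>y. vadd P n x y) ` I n"

text \<open>As for \<open>rcoset_mult\<close>, operations on cosets are unions over all representatives.\<close>

definition quotient_operad ::
  "('k, 'v) ns_operad \<Rightarrow> (nat \<Rightarrow> 'v set) \<Rightarrow> ('k, 'v set) ns_operad" where
  "quotient_operad P I =
     \<lparr>component = \<lambda>n. vcoset P I n ` component P n,
      vzero = \<lambda>n. vcoset P I n (vzero P n),
      vadd = \<lambda>n X Y. \<Union>x\<in>X. \<Union>y\<in>Y. vcoset P I n (vadd P n x y),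
      vscale = \<lambda>n c X. \<Union>x\<in>X. vcoset P I n (vscale P n c x),
      pcomp = \<lambda>m n i X Y. \<Union>x\<in>X. \<Union>y\<in>Y. vcoset P I (m + n - 1) (pcomp P m n i x y),
      opunit = vcoset P I 1 (opunit P)\<rparr>"

definition operad_iso ::
  "('k, 'v) ns_operad \<Rightarrow> ('k, 'w) ns_operad \<Rightarrow> (nat \<Rightarrow> 'v \<Rightarrow> 'w) \<Rightarrow> bool" where
  "operad_iso P Q f \<longleftrightarrow>
     (\<forall>n. bij_betw (f n) (component P n) (component Q n)) \<and>
     (\<forall>n. \<forall>x\<in>component P n. \<forall>y\<in>component P n. f n (vadd P n x y) = vadd Q n (f n x) (f n y)) \<and>
     (\<forall>n c. \<forall>x\<in>component P n. f n (vscale P n c x) = vscale Q n c (f n x)) \<and>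
     (\<forall>m n i. \<forall>x\<in>component P m. \<forall>y\<in>component P n. i \<in> {1..m} \<longrightarrow>
        f (m + n - 1) (pcomp P m n i x y) = pcomp Q m n i (f m x) (f n y)) \<and>
     f 1 (opunit P) = opunit Q"

definition operad_isomorphic ::
  "('k, 'v) ns_operad \<Rightarrow> ('k, 'w) ns_operad \<Rightarrow> bool"  (infix "\<cong>\<^sub>o\<^sub>p" 50) where
  "P \<cong>\<^sub>o\<^sub>p Q \<longleftrightarrow> (\<exists>f. operad_iso P Q f)"


section \<open>Linear operads with a combinatorial basis\<close>

definition pm_scale :: "'k \<Rightarrow> ('b \<Rightarrow>\<^sub>0 'k) \<Rightarrow> ('b \<Rightarrow>\<^sub>0 'k::field)" where
  "pm_scale c x = Poly_Mapping.map ((*) c) x"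

lemma lookup_pm_scale [simp]: "Poly_Mapping.lookup (pm_scale c x) b = c * Poly_Mapping.lookup x b"
  by (simp add: pm_scale_def Poly_Mapping.map.rep_eq when_def)

interpretation pm: vector_space "pm_scale :: 'k::field \<Rightarrow> ('b \<Rightarrow>\<^sub>0 'k) \<Rightarrow> ('b \<Rightarrow>\<^sub>0 'k)"
  by unfold_locales (auto intro!: poly_mapping_eqI simp: lookup_add algebra_simps)

text \<open>
  The operad whose arity-\<open>n\<close> component has as basis the elements of \<open>B\<close> of arity \<open>n\<close>, with the
  bilinear extension of a composition \<open>c i s t\<close> (\<open>s \<circ>\<^sub>i t\<close>) of basis elements.
\<close>

definition linear_operad ::
  "'b set \<Rightarrow> ('b \<Rightarrow> nat) \<Rightarrow> (nat \<Rightarrow> 'b \<Rightarrow> 'b \<Rightarrow> 'b) \<Rightarrow> 'b \<Rightarrow> ('k::field, 'b \<Rightarrow>\<^sub>0 'k) ns_operad" where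
  "linear_operad B ar c e =
     \<lparr>component = \<lambda>n. {x. Poly_Mapping.keys x \<subseteq> {b \<in> B. ar b = n}},
      vzero = \<lambda>_. 0,
      vadd = \<lambda>_. (+),
      vscale = \<lambda>_. pm_scale,
      pcomp = \<lambda>_ _ i x y. \<Sum>s\<in>Poly_Mapping.keys x. \<Sum>t\<in>Poly_Mapping.keys y.
                Poly_Mapping.single (c i s t) (Poly_Mapping.lookup x s * Poly_Mapping.lookup y t),
      opunit = Poly_Mapping.single e 1\<rparr>"


section \<open>The free operad on a graded set\<close>

text \<open>
  Planar rooted trees with labelled internal nodes.  A graded set is a set \<open>S\<close> of labels with an
  arity function \<open>ar\<close>; the arity of a tree is its number of leaves, and the unit is the tree
  reduced to one leaf.
\<close>

datatype 'g ptree = Leaf | Node 'g "'g ptree list"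

fun leaves :: "'g ptree \<Rightarrow> nat" where
  "leaves Leaf = 1"
| "leaves (Node g ts) = sum_list (map leaves ts)"

fun well_labelled :: "'g set \<Rightarrow> ('g \<Rightarrow> nat) \<Rightarrow> 'g ptree \<Rightarrow> bool" where
  "well_labelled S ar Leaf \<longleftrightarrow> True"
| "well_labelled S ar (Node g ts) \<longleftrightarrow>
     g \<in> S \<and> length ts = ar g \<and> (\<forall>t\<in>set ts. well_labelled S ar t)"

text \<open>\<open>graft i s t\<close> grafts \<open>t\<close> on the \<open>i\<close>-th leaf of \<open>s\<close>, leaves being numbered from \<open>1\<close>.\<close>

fun graft :: "nat \<Rightarrow> 'g ptree \<Rightarrow> 'g ptree \<Rightarrow> 'g ptree"
  and graft_list :: "nat \<Rightarrow> 'g ptree list \<Rightarrow> 'g ptree \<Rightarrow> 'g ptree list" where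
  "graft i Leaf t = t"
| "graft i (Node g ss) t = Node g (graft_list i ss t)"
| "graft_list i [] t = []"
| "graft_list i (s # ss) t =
     (if i \<le> leaves s then graft i s t # ss else s # graft_list (i - leaves s) ss t)"

definition free_operad ::
  "'g set \<Rightarrow> ('g \<Rightarrow> nat) \<Rightarrow> ('k::field, 'g ptree \<Rightarrow>\<^sub>0 'k) ns_operad" where
  "free_operad S ar = linear_operad {t. well_labelled S ar t} leaves graft Leaf"

definition corolla :: "('g \<Rightarrow> nat) \<Rightarrow> 'g \<Rightarrow> 'g ptree \<Rightarrow>\<^sub>0 'k::field" where
  "corolla ar g = Poly_Mapping.single (Node g (replicate (ar g) Leaf)) 1"


section \<open>The pluriassociative operads\<close>

definition word_comp :: "nat \<Rightarrow> nat list \<Rightarrow> nat list \<Rightarrow> nat list" where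
  "word_comp i u v = take (i - 1) u @ map (max (u ! (i - 1))) v @ drop i u"

definition word_operad :: "nat \<Rightarrow> ('k::field, nat list \<Rightarrow>\<^sub>0 'k) ns_operad" where
  "word_operad \<gamma> = linear_operad {w. w \<noteq> [] \<and> set w \<subseteq> {0..\<gamma>}} length word_comp [0]"

definition Dias :: "nat \<Rightarrow> ('k::field, nat list \<Rightarrow>\<^sub>0 'k) ns_operad" where
  "Dias \<gamma> = suboperad_generated (word_operad \<gamma>)
     (\<lambda>n. if n = 2 then (\<Union>a\<in>{1..\<gamma>}. {Poly_Mapping.single [0, a] 1, Poly_Mapping.single [a, 0] 1})
          else {})"

text \<open>\<open>Dashv a\<close> is \<open>\<stileturn>\<^sub>a\<close> (the word \<open>0a\<close>) and \<open>Vdash a\<close> is \<open>\<turnstile>\<^sub>a\<close> (the word \<open>a0\<close>).\<close>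

datatype dias_gen = Dashv nat | Vdash nat

definition dias_gens :: "nat \<Rightarrow> dias_gen set" where
  "dias_gens \<gamma> = Dashv ` {1..\<gamma>} \<union> Vdash ` {1..\<gamma>}"

definition gen_arity :: "dias_gen \<Rightarrow> nat" where
  "gen_arity _ = 2"

abbreviation Free_Dias :: "nat \<Rightarrow> ('k::field, dias_gen ptree \<Rightarrow>\<^sub>0 'k) ns_operad" where
  "Free_Dias \<gamma> \<equiv> free_operad (dias_gens \<gamma>) gen_arity"

definition bdashv :: "nat \<Rightarrow> nat \<Rightarrow> dias_gen ptree \<Rightarrow>\<^sub>0 'k::field" where
  "bdashv \<gamma> a = (if a = \<gamma> then corolla gen_arity (Dashv \<gamma>)
     else corolla gen_arity (Dashv a) - corolla gen_arity (Dashv (a + 1)))"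

definition bvdash :: "nat \<Rightarrow> nat \<Rightarrow> dias_gen ptree \<Rightarrow>\<^sub>0 'k::field" where
  "bvdash \<gamma> a = (if a = \<gamma> then corolla gen_arity (Vdash \<gamma>)
     else corolla gen_arity (Vdash a) - corolla gen_arity (Vdash (a + 1)))"

definition bar_gens :: "nat \<Rightarrow> (dias_gen ptree \<Rightarrow>\<^sub>0 'k::field) set" where
  "bar_gens \<gamma> = bdashv \<gamma> ` {1..\<gamma>} \<union> bvdash \<gamma> ` {1..\<gamma>}"

definition bar_relations :: "nat \<Rightarrow> (dias_gen ptree \<Rightarrow>\<^sub>0 'k::field) set" where
  "bar_relations \<gamma> =
    (let L = bdashv \<gamma>; R = bvdash \<gamma>;
         c1 = pcomp (Free_Dias \<gamma>) 2 2 1; c2 = pcomp (Free_Dias \<gamma>) 2 2 2 in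
       (\<Union>a\<in>{1..\<gamma>}. \<Union>a'\<in>{1..\<gamma>}. {c1 (L a) (R a') - c2 (R a') (L a)}) \<union>
       (\<Union>b\<in>{1..\<gamma>}. \<Union>a\<in>{1..<b}.
          {c1 (R b) (R a),
           c2 (L b) (L a),
           c1 (R b) (L a),
           c2 (L b) (R a),
           c1 (R a) (R b) - c2 (R b) (R a),
           c1 (L b) (L a) - c2 (L a) (L b),
           c1 (R a) (L b) - c2 (R a) (R b),
           c1 (L a) (L b) - c2 (L a) (R b)}) \<union>
       (\<Union>a\<in>{1..\<gamma>}.
          {c1 (R a) (R a) - (\<Sum>b\<in>{a..\<gamma>}. c2 (R a) (R b)),
           (\<Sum>b\<in>{a..\<gamma>}. c1 (L a) (L b)) - c2 (L a) (L a),
           c1 (R a) (L a) - (\<Sum>b\<in>{a..\<gamma>}. c2 (R b) (R a)),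
           (\<Sum>b\<in>{a..\<gamma>}. c1 (L b) (L a)) - c2 (L a) (R a)}))"

text \<open>
  A presentation of \<open>P\<close> whose generators form a graded family \<open>G\<close> inside a free operad
  \<open>free_operad S ar\<close>: in each arity, \<open>G\<close> is a basis of the space spanned by the corollas (that is,
  by \<open>S\<close>), so that the free operad on \<open>G\<close> is identified with \<open>free_operad S ar\<close>; the relations \<open>R\<close>
  are taken in the latter.
\<close>

definition admits_presentation ::
  "('k::field, 'v) ns_operad \<Rightarrow> 'g set \<Rightarrow> ('g \<Rightarrow> nat) \<Rightarrow>
   (nat \<Rightarrow> ('g ptree \<Rightarrow>\<^sub>0 'k) set) \<Rightarrow> (nat \<Rightarrow> ('g ptree \<Rightarrow>\<^sub>0 'k) set) \<Rightarrow> bool" where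
  "admits_presentation P S ar G R \<longleftrightarrow>
     (\<forall>n. pm.independent (G n) \<and> pm.span (G n) = pm.span (corolla ar ` {g \<in> S. ar g = n})) \<and>
     (\<forall>n. R n \<subseteq> component (free_operad S ar) n) \<and>
     P \<cong>\<^sub>o\<^sub>p quotient_operad (free_operad S ar) (ideal_generated (free_operad S ar) R)"

end

theory Submission
  imports Defs
begin

text \<open>
  Evaluating trees as words is an operad morphism from the free operad onto the pluriassociative
  operad, so it suffices to show that its kernel is the ideal of the barred relations.  Since
  \<open>\<stileturn>\<^sub>a\<close> is the sum of the \<open>bdashv \<gamma> b\<close> with \<open>b \<ge> a\<close> (and likewise for \<open>\<turnstile>\<^sub>a\<close>), summing the barred
  relations yields, with \<open>m = max a b\<close>, the relations between single trees
  \<open>(x \<turnstile>\<^sub>b y) \<stileturn>\<^sub>a z = x \<turnstile>\<^sub>b (y \<stileturn>\<^sub>a z)\<close>,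
  \<open>x \<stileturn>\<^sub>a (y \<stileturn>\<^sub>b z) = (x \<stileturn>\<^sub>a y) \<stileturn>\<^sub>m z\<close>,
  \<open>x \<stileturn>\<^sub>a (y \<turnstile>\<^sub>b z) = (x \<stileturn>\<^sub>m y) \<stileturn>\<^sub>a z\<close>,
  \<open>(x \<turnstile>\<^sub>b y) \<turnstile>\<^sub>a z = x \<turnstile>\<^sub>m (y \<turnstile>\<^sub>a z)\<close>,
  \<open>(x \<stileturn>\<^sub>b y) \<turnstile>\<^sub>a z = x \<turnstile>\<^sub>a (y \<turnstile>\<^sub>m z)\<close>.
  They rewrite every tree into the normal form
  \<open>u\<^sub>1 \<turnstile> (\<dots> (u\<^sub>k \<turnstile> ((\<bar> \<stileturn> v\<^sub>1) \<dots> \<stileturn> v\<^sub>l)))\<close>, where \<open>\<bar>\<close> is the leaf and letters abbreviate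
  operation indices; this form is read off the word \<open>u\<^sub>1\<dots>u\<^sub>k 0 v\<^sub>1\<dots>v\<^sub>l\<close> of the tree.
\<close>

section \<open>Linear extensions of maps on bases\<close>

abbreviation pm_linear :: "(('b \<Rightarrow>\<^sub>0 'k::field) \<Rightarrow> ('c \<Rightarrow>\<^sub>0 'k)) \<Rightarrow> bool" where
  "pm_linear \<equiv> Vector_Spaces.linear pm_scale pm_scale"

lemma pm_linearI:
  assumes "\<And>x y. f (x + y) = f x + f y" "\<And>c x. f (pm_scale c x) = pm_scale c (f x)"
  shows "pm_linear f"
  by (intro Vector_Spaces.linear.intro module_hom.intro module_hom_axioms.intro
      pm.vector_space_axioms pm.module_axioms assms)

lemmas linear_module_hom = Vector_Spaces.linear.axioms(3)
lemmas linear_add = module_hom.add[OF linear_module_hom]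
lemmas linear_scale = module_hom.scale[OF linear_module_hom]
lemmas linear_diff = module_hom.diff[OF linear_module_hom]
lemmas linear_sum = module_hom.sum[OF linear_module_hom]
lemmas linear_zero = module_hom.zero[OF linear_module_hom]

lemma keys_pm_scale:
  fixes x :: "'b \<Rightarrow>\<^sub>0 'k::field"
  shows "Poly_Mapping.keys (pm_scale c x) \<subseteq> Poly_Mapping.keys x"
  by (auto simp: in_keys_iff)

lemma pm_scale_single [simp]:
  "pm_scale c (Poly_Mapping.single b d) = Poly_Mapping.single b (c * d)"
  by (rule poly_mapping_eqI) (simp add: lookup_single when_def)

definition extend :: "('b \<Rightarrow> 'c) \<Rightarrow> ('b \<Rightarrow>\<^sub>0 'k::field) \<Rightarrow> ('c \<Rightarrow>\<^sub>0 'k)" where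
  "extend h x = (\<Sum>b\<in>Poly_Mapping.keys x. Poly_Mapping.single (h b) (Poly_Mapping.lookup x b))"

text \<open>Cancellation can make the key sets of \<open>x\<close>, \<open>y\<close> and
  \<open>x + y\<close> differ, so additivity is read off from sums over one common index
  set.\<close>

lemma extend_superset:
  assumes "finite A" "Poly_Mapping.keys x \<subseteq> A"
  shows "extend h x = (\<Sum>b\<in>A. Poly_Mapping.single (h b) (Poly_Mapping.lookup x b))"
  unfolding extend_def using assms by (intro sum.mono_neutral_left) (auto simp: in_keys_iff)

lemma linear_extend:
  fixes h :: "'b \<Rightarrow> 'c"
  shows "pm_linear (extend h :: ('b \<Rightarrow>\<^sub>0 'k::field) \<Rightarrow> ('c \<Rightarrow>\<^sub>0 'k))"
proof (rule pm_linearI)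
  fix x y :: "'b \<Rightarrow>\<^sub>0 'k"
  let ?A = "Poly_Mapping.keys x \<union> Poly_Mapping.keys y"
  have "extend h z = (\<Sum>b\<in>?A. Poly_Mapping.single (h b) (Poly_Mapping.lookup z b))"
    if "z \<in> {x, y, x + y}" for z
    using that keys_add[of x y] by (intro extend_superset) auto
  then show "extend h (x + y) = extend h x + extend h y"
    by (simp add: lookup_add single_add sum.distrib)
next
  fix c :: 'k and x :: "'b \<Rightarrow>\<^sub>0 'k"
  show "extend h (pm_scale c x) = pm_scale c (extend h x)"
    by (subst extend_superset[OF finite_keys keys_pm_scale])
      (simp add: extend_def pm.scale_sum_right)
qed

lemma extend_single [simp]: "extend h (Poly_Mapping.single b c) = Poly_Mapping.single (h b) c"
  by (simp add: extend_superset[of "{b}"])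

lemma extend_id: "extend (\<lambda>b. b) x = x"
  by (rule poly_mapping_eqI) (auto simp: extend_def lookup_sum lookup_single when_def in_keys_iff)

lemma extend_extend: "extend g (extend h x) = extend (\<lambda>b. g (h b)) x"
  unfolding extend_def[of h] by (simp add: linear_sum[OF linear_extend]) (simp add: extend_def)

text \<open>This is the body of \<open>pcomp\<close> in \<open>linear_operad\<close>, isolated so
  that linearity in each argument is available for any composition of basis elements.\<close>

definition bilinear_extend ::
  "('b \<Rightarrow> 'c \<Rightarrow> 'd) \<Rightarrow> ('b \<Rightarrow>\<^sub>0 'k::field) \<Rightarrow> ('c \<Rightarrow>\<^sub>0 'k) \<Rightarrow> ('d \<Rightarrow>\<^sub>0 'k)" where
  "bilinear_extend c x y = (\<Sum>s\<in>Poly_Mapping.keys x. \<Sum>t\<in>Poly_Mapping.keys y.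
     Poly_Mapping.single (c s t) (Poly_Mapping.lookup x s * Poly_Mapping.lookup y t))"

text \<open>With one argument fixed, the bilinear extension is a linear combination of maps
  \<open>extend\<close>, which gives linearity in the other argument.\<close>

lemma bilinear_extend_left:
  "bilinear_extend c x y =
     (\<Sum>t\<in>Poly_Mapping.keys y. pm_scale (Poly_Mapping.lookup y t) (extend (\<lambda>s. c s t) x))"
  unfolding bilinear_extend_def extend_def
  by (subst sum.swap) (simp add: pm.scale_sum_right mult.commute)

lemma bilinear_extend_right:
  "bilinear_extend c x y =
     (\<Sum>s\<in>Poly_Mapping.keys x. pm_scale (Poly_Mapping.lookup x s) (extend (c s) y))"
  unfolding bilinear_extend_def extend_def by (simp add: pm.scale_sum_right)

lemma linear_bilinear_extend_left: "pm_linear (\<lambda>x. bilinear_extend c x y)"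
  unfolding bilinear_extend_left
  by (rule pm_linearI)
    (simp_all add: linear_add[OF linear_extend] linear_scale[OF linear_extend]
      pm.scale_right_distrib sum.distrib pm.scale_sum_right mult.commute)

lemma linear_bilinear_extend_right: "pm_linear (bilinear_extend c x)"
  unfolding bilinear_extend_right
  by (rule pm_linearI)
    (simp_all add: linear_add[OF linear_extend] linear_scale[OF linear_extend]
      pm.scale_right_distrib sum.distrib pm.scale_sum_right mult.commute)

lemmas bilinear_simps =
  linear_diff[OF linear_bilinear_extend_left] linear_diff[OF linear_bilinear_extend_right]
  linear_sum[OF linear_bilinear_extend_left] linear_sum[OF linear_bilinear_extend_right]
  linear_zero[OF linear_bilinear_extend_left] linear_zero[OF linear_bilinear_extend_right]

lemma bilinear_extend_single [simp]:
  "bilinear_extend c (Poly_Mapping.single s a) (Poly_Mapping.single t b) =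
     Poly_Mapping.single (c s t) (a * b)"
  by (cases "a = 0"; cases "b = 0") (simp_all add: bilinear_extend_def)

text \<open>Compatibility is asked on keys only, because for words of grafted trees it is
  established for well-labelled trees with at least \<open>i\<close> leaves.\<close>

lemma extend_bilinear_extend:
  assumes "\<And>s t. s \<in> Poly_Mapping.keys x \<Longrightarrow> t \<in> Poly_Mapping.keys y \<Longrightarrow> h (c s t) = d (h s) (h t)"
  shows "extend h (bilinear_extend c x y) = bilinear_extend d (extend h x) (extend h y)"
  unfolding bilinear_extend_def[of c] extend_def[of h x] extend_def[of h y]
  by (simp add: linear_sum[OF linear_extend] bilinear_simps assms) (rule sum.swap)

lemma keys_sum_subset:
  assumes "\<And>a. a \<in> A \<Longrightarrow> Poly_Mapping.keys (f a) \<subseteq> K"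
  shows "Poly_Mapping.keys (\<Sum>a\<in>A. f a) \<subseteq> K"
  using keys_sum[of f A] assms by blast

lemma keys_bilinear_extend:
  assumes "\<And>s t. s \<in> Poly_Mapping.keys x \<Longrightarrow> t \<in> Poly_Mapping.keys y \<Longrightarrow> c s t \<in> K"
  shows "Poly_Mapping.keys (bilinear_extend c x y) \<subseteq> K"
  unfolding bilinear_extend_def using assms by (intro keys_sum_subset) auto

text \<open>The coordinate at \<open>b\<close> vanishes on the span of the other basis vectors, but
  not on the one at \<open>b\<close>.\<close>

lemma independent_singles:
  "pm.independent ((\<lambda>b. Poly_Mapping.single b (1 :: 'k::field)) ` B)"
proof
  let ?s = "\<lambda>b. Poly_Mapping.single b (1 :: 'k)"
  assume "pm.dependent (?s ` B)"
  then obtain b where b: "?s b \<in> pm.span (?s ` B - {?s b})"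
    by (auto simp: pm.dependent_def)
  have "pm.span (?s ` B - {?s b}) \<subseteq> {z. Poly_Mapping.lookup z b = 0}"
    by (rule pm.span_minimal) (auto simp: pm.subspace_def lookup_add lookup_single when_def)
  with b show False
    by auto
qed


section \<open>Quotients of linear operads\<close>

lemma component_linear_operad:
  "component (linear_operad B ar c e) n = {x. Poly_Mapping.keys x \<subseteq> {b \<in> B. ar b = n}}"
  and vzero_linear_operad [simp]: "vzero (linear_operad B ar c e) n = 0"
  and vadd_linear_operad [simp]: "vadd (linear_operad B ar c e) n = (+)"
  and vscale_linear_operad [simp]: "vscale (linear_operad B ar c e) n = pm_scale"
  and pcomp_linear_operad [simp]: "pcomp (linear_operad B ar c e) m n i = bilinear_extend (c i)"
  and opunit_linear_operad [simp]: "opunit (linear_operad B ar c e) = Poly_Mapping.single e 1"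
  by (simp_all add: linear_operad_def bilinear_extend_def fun_eq_iff)

lemma subspace_component_linear_operad: "pm.subspace (component (linear_operad B ar c e) n)"
  unfolding pm.subspace_def component_linear_operad
  by (auto dest!: subsetD[OF keys_add] subsetD[OF keys_pm_scale])

lemma graded_subspace_linear_operad:
  "graded_subspace (linear_operad B ar c e) Q \<longleftrightarrow>
     (\<forall>n. Q n \<subseteq> component (linear_operad B ar c e) n \<and> pm.subspace (Q n))"
  by (auto simp: graded_subspace_def pm.subspace_def)

text \<open>The first isomorphism theorem for operads. The isomorphism sends an element to its fibre
  under \<open>\<phi>\<close>, which is a coset of the kernel.\<close>

lemma isomorphic_quotient_operad:
  fixes \<phi> :: "('b \<Rightarrow>\<^sub>0 'k::field) \<Rightarrow> ('c \<Rightarrow>\<^sub>0 'k)"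
    and P :: "('k, 'b \<Rightarrow>\<^sub>0 'k) ns_operad" and Q :: "('k, 'c \<Rightarrow>\<^sub>0 'k) ns_operad"
  assumes lin: "pm_linear \<phi>"
    and addP: "\<And>n. vadd P n = (+)" and scaleP: "\<And>n. vscale P n = pm_scale"
    and sub: "\<And>n. pm.subspace (component P n)"
    and add: "\<And>n. vadd Q n = (+)" and scale: "\<And>n. vscale Q n = pm_scale"
    and image: "\<And>n. component Q n = \<phi> ` component P n"
    and closed: "\<And>m n i x y. x \<in> component P m \<Longrightarrow> y \<in> component P n \<Longrightarrow> i \<in> {1..m} \<Longrightarrow>
      pcomp P m n i x y \<in> component P (m + n - 1)"
    and unit_closed: "opunit P \<in> component P 1"
    and comp: "\<And>m n i x y. x \<in> component P m \<Longrightarrow> y \<in> component P n \<Longrightarrow> i \<in> {1..m} \<Longrightarrow>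
      \<phi> (pcomp P m n i x y) = pcomp Q m n i (\<phi> x) (\<phi> y)"
    and unit: "\<phi> (opunit P) = opunit Q"
    and ker: "\<And>n. I n = {x \<in> component P n. \<phi> x = 0}"
  shows "Q \<cong>\<^sub>o\<^sub>p quotient_operad P I"
proof -
  define f where "f n z = {x \<in> component P n. \<phi> x = z}" for n z
  have coset: "vcoset P I n x = f n (\<phi> x)" if x: "x \<in> component P n" for n x
  proof (intro set_eqI iffI)
    fix y assume "y \<in> f n (\<phi> x)"
    then have "y - x \<in> I n" "y = x + (y - x)"
      using x pm.subspace_diff[OF sub] by (auto simp: ker f_def linear_diff[OF lin])
    then show "y \<in> vcoset P I n x"
      unfolding vcoset_def addP by (rule image_eqI[rotated])
  next
    fix y assume "y \<in> vcoset P I n x"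
    then show "y \<in> f n (\<phi> x)"
      using x pm.subspace_add[OF sub]
      by (auto simp: vcoset_def ker f_def linear_add[OF lin] addP)
  qed
  have "operad_iso Q (quotient_operad P I) f"
    unfolding operad_iso_def
  proof (intro conjI allI ballI impI)
    fix n
    have "inj_on (f n) (component Q n)"
      unfolding inj_on_def image f_def by blast
    moreover have "f n ` component Q n = component (quotient_operad P I) n"
      unfolding image image_image by (simp add: quotient_operad_def coset cong: image_cong)
    ultimately show "bij_betw (f n) (component Q n) (component (quotient_operad P I) n)"
      by (simp add: bij_betw_def)
  next
    fix n u v assume "u \<in> component Q n" "v \<in> component Q n"
    \<comment> \<open>Operations on cosets are unions over representatives; a union of copies of one
      set is that set only over a nonempty index set.\<close>
    then have ne: "f n u \<noteq> {}" "f n v \<noteq> {}"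
      by (auto simp: image f_def)
    have "vcoset P I n (vadd P n x y) = f n (u + v)" if "x \<in> f n u" "y \<in> f n v" for x y
      using that pm.subspace_add[OF sub]
      by (subst coset) (auto simp: f_def linear_add[OF lin] addP)
    then show "f n (vadd Q n u v) = vadd (quotient_operad P I) n (f n u) (f n v)"
      using ne by (auto simp: quotient_operad_def add)
  next
    fix n k u assume "u \<in> component Q n"
    then have ne: "f n u \<noteq> {}"
      by (auto simp: image f_def)
    have "vcoset P I n (vscale P n k x) = f n (pm_scale k u)" if "x \<in> f n u" for x
      using that pm.subspace_scale[OF sub]
      by (subst coset) (auto simp: f_def linear_scale[OF lin] scaleP)
    then show "f n (vscale Q n k u) = vscale (quotient_operad P I) n k (f n u)"
      using ne by (auto simp: quotient_operad_def scale)
  next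
    fix m n i u v assume "u \<in> component Q m" "v \<in> component Q n" and i: "i \<in> {1..m}"
    then have ne: "f m u \<noteq> {}" "f n v \<noteq> {}"
      by (auto simp: image f_def)
    have "vcoset P I (m + n - 1) (pcomp P m n i x y) = f (m + n - 1) (pcomp Q m n i u v)"
      if "x \<in> f m u" "y \<in> f n v" for x y
      using that i closed comp by (subst coset) (auto simp: f_def)
    then show "f (m + n - 1) (pcomp Q m n i u v) =
        pcomp (quotient_operad P I) m n i (f m u) (f n v)"
      using ne by (auto simp: quotient_operad_def)
  next
    show "f 1 (opunit Q) = opunit (quotient_operad P I)"
      using unit_closed by (simp add: quotient_operad_def coset unit)
  qed
  then show ?thesis
    unfolding operad_isomorphic_def by blast
qed

section \<open>Trees and words\<close>

lemma leaves_graft: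
  "1 \<le> i \<Longrightarrow> i \<le> leaves s \<Longrightarrow> leaves (graft i s t) = leaves s + leaves t - 1"
  "1 \<le> i \<Longrightarrow> i \<le> sum_list (map leaves ss) \<Longrightarrow>
     sum_list (map leaves (graft_list i ss t)) = sum_list (map leaves ss) + leaves t - 1"
  by (induction i s t and i ss t rule: graft_graft_list.induct) auto

lemma length_graft_list [simp]: "length (graft_list i ss t) = length ss"
  by (induction ss arbitrary: i) auto

lemma well_labelled_graft:
  "well_labelled S ar s \<Longrightarrow> well_labelled S ar t \<Longrightarrow> well_labelled S ar (graft i s t)"
  "(\<forall>s\<in>set ss. well_labelled S ar s) \<Longrightarrow> well_labelled S ar t \<Longrightarrow>
     (\<forall>s\<in>set (graft_list i ss t). well_labelled S ar s)"
  by (induction i s t and i ss t rule: graft_graft_list.induct) auto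

lemma component_free_operad:
  "component (free_operad S ar) n =
     {x. Poly_Mapping.keys x \<subseteq> {t. well_labelled S ar t \<and> leaves t = n}}"
  by (simp add: free_operad_def component_linear_operad)

lemma pcomp_free_operad [simp]: "pcomp (free_operad S ar) m n i = bilinear_extend (graft i)"
  by (simp add: free_operad_def)

lemma subspace_component_free_operad: "pm.subspace (component (free_operad S ar) n)"
  unfolding free_operad_def by (rule subspace_component_linear_operad)

lemma pcomp_free_operad_closed:
  assumes "x \<in> component (free_operad S ar) m" "y \<in> component (free_operad S ar) n" "i \<in> {1..m}"
  shows "bilinear_extend (graft i) x y \<in> component (free_operad S ar) (m + n - 1)"
  using assms unfolding component_free_operad mem_Collect_eq
  by (intro keys_bilinear_extend) (auto simp: leaves_graft well_labelled_graft dest!: subsetD)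

section \<open>Binary trees over the generators and their words\<close>

abbreviation dias_tree :: "nat \<Rightarrow> dias_gen ptree \<Rightarrow> bool" where
  "dias_tree \<gamma> \<equiv> well_labelled (dias_gens \<gamma>) gen_arity"

lemma Dashv_in_dias_gens [simp]: "Dashv a \<in> dias_gens \<gamma> \<longleftrightarrow> a \<in> {1..\<gamma>}"
  and Vdash_in_dias_gens [simp]: "Vdash a \<in> dias_gens \<gamma> \<longleftrightarrow> a \<in> {1..\<gamma>}"
  by (auto simp: dias_gens_def)

lemma gen_arity_simps [simp]: "gen_arity (Dashv a) = 2" "gen_arity (Vdash a) = 2"
  by (simp_all add: gen_arity_def)

text \<open>All generators are binary, so a well-labelled tree is a leaf or a node with exactly two
  subtrees.\<close>

lemma dias_tree_induct [consumes 1, case_names Leaf Dashv Vdash]: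
  assumes "dias_tree \<gamma> t" "P Leaf"
    and "\<And>a l r. a \<in> {1..\<gamma>} \<Longrightarrow> dias_tree \<gamma> l \<Longrightarrow> dias_tree \<gamma> r \<Longrightarrow> P l \<Longrightarrow> P r \<Longrightarrow>
      P (Node (Dashv a) [l, r])"
    and "\<And>a l r. a \<in> {1..\<gamma>} \<Longrightarrow> dias_tree \<gamma> l \<Longrightarrow> dias_tree \<gamma> r \<Longrightarrow> P l \<Longrightarrow> P r \<Longrightarrow>
      P (Node (Vdash a) [l, r])"
  shows "P t"
  using assms(1)
proof (induction t)
  case Leaf
  show ?case by (rule assms(2))
next
  case (Node g ts)
  then obtain l r where ts: "ts = [l, r]"
    by (cases g) (auto simp: length_Suc_conv numeral_2_eq_2)
  with Node have lr: "dias_tree \<gamma> l" "dias_tree \<gamma> r" "P l" "P r" "g \<in> dias_gens \<gamma>"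
    by auto
  show ?case
    using lr assms(3,4) unfolding ts by (cases g) auto
qed

text \<open>The value of a tree in the word operad: substituting into \<open>0a\<close> keeps the
  left word, as the maximum with 0 changes nothing, and raises the right one by
  \<open>max a\<close>; dually for \<open>a0\<close>. The last equation gives the leaf the unit word
  and is a default on nodes without exactly two subtrees.\<close>

fun tree_word :: "dias_gen ptree \<Rightarrow> nat list" where
  "tree_word (Node (Dashv a) [l, r]) = tree_word l @ map (max a) (tree_word r)"
| "tree_word (Node (Vdash a) [l, r]) = map (max a) (tree_word l) @ tree_word r"
| "tree_word t = [0]"

lemma length_tree_word: "dias_tree \<gamma> t \<Longrightarrow> length (tree_word t) = leaves t"
  by (induction rule: dias_tree_induct) auto

lemma set_tree_word: "dias_tree \<gamma> t \<Longrightarrow> set (tree_word t) \<subseteq> {0..\<gamma>}"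
  by (induction rule: dias_tree_induct) auto

lemma leaves_pos: "dias_tree \<gamma> t \<Longrightarrow> 1 \<le> leaves t"
  by (induction rule: dias_tree_induct) auto

text \<open>The two cases mirror the descent of \<open>graft_list\<close> into the left or the right
  subtree.\<close>

lemma word_comp_append:
  "i \<in> {1..length u} \<Longrightarrow> word_comp i (u @ w) v = word_comp i u v @ w"
  "\<not> i \<le> length u \<Longrightarrow> word_comp i (u @ w) v = u @ word_comp (i - length u) w v"
  by (auto simp: word_comp_def nth_append)

lemma map_max_word_comp:
  "i \<in> {1..length u} \<Longrightarrow> map (max a) (word_comp i u v) = word_comp i (map (max a) u) v"
  by (auto simp: word_comp_def take_map drop_map max.assoc)

text \<open>The grafted leaf lies in one of the two subtrees, and raising letters by
  \<open>max a\<close> commutes with composition by associativity of the maximum.\<close>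

lemma tree_word_graft:
  assumes "dias_tree \<gamma> s" "i \<in> {1..leaves s}"
  shows "tree_word (graft i s t) = word_comp i (tree_word s) (tree_word t)"
  using assms
proof (induction arbitrary: i rule: dias_tree_induct)
  case Leaf
  then show ?case
    by (simp add: word_comp_def max_def cong: map_cong)
next
  case (Dashv a l r)
  then show ?case
    by (cases "i \<le> leaves l")
      (auto simp: word_comp_append map_max_word_comp length_tree_word)
next
  case (Vdash a l r)
  then show ?case
    by (cases "i \<le> leaves l")
      (auto simp: word_comp_append map_max_word_comp length_tree_word)
qed


section \<open>The evaluation morphism\<close>

lemma extend_tree_word_pcomp:
  assumes "x \<in> component (Free_Dias \<gamma>) m" "y \<in> component (Free_Dias \<gamma>) n" "i \<in> {1..m}"
  shows "extend tree_word (bilinear_extend (graft i) x y) =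
    bilinear_extend (word_comp i) (extend tree_word x) (extend tree_word y)"
  using assms unfolding component_free_operad
  by (intro extend_bilinear_extend) (auto intro!: tree_word_graft)

lemma word_operad_simps [simp]:
  "vadd (word_operad \<gamma>) n = (+)" "vscale (word_operad \<gamma>) n = pm_scale"
  "pcomp (word_operad \<gamma>) m n i = bilinear_extend (word_comp i)"
  "opunit (word_operad \<gamma>) = Poly_Mapping.single [0] 1"
  by (simp_all add: word_operad_def)

lemma Dias_simps [simp]:
  "vadd (Dias \<gamma>) n = (+)" "vscale (Dias \<gamma>) n = pm_scale"
  "pcomp (Dias \<gamma>) m n i = bilinear_extend (word_comp i)"
  "opunit (Dias \<gamma>) = Poly_Mapping.single [0] 1"
  by (simp_all add: Dias_def suboperad_generated_def)

text \<open>The image of evaluation is a suboperad containing the generators; conversely, any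
  suboperad containing them contains the word of every tree, by induction on trees.\<close>

lemma component_Dias_eq_image:
  "component (Dias \<gamma>) n = extend tree_word ` component (Free_Dias \<gamma> :: ('k::field, _) ns_operad) n"
    (is "_ = ?E n")
proof (rule antisym)
  let ?W = "word_operad \<gamma> :: ('k, nat list \<Rightarrow>\<^sub>0 'k) ns_operad"
  let ?F = "Free_Dias \<gamma> :: ('k, dias_gen ptree \<Rightarrow>\<^sub>0 'k) ns_operad"
  let ?X = "\<lambda>n. if n = 2
    then \<Union>a\<in>{1..\<gamma>}. {Poly_Mapping.single [0, a] (1 :: 'k), Poly_Mapping.single [a, 0] 1} else {}"
  have Dias: "component (Dias \<gamma>) n = \<Inter>{Q n | Q. is_suboperad ?W Q \<and> (\<forall>k. ?X k \<subseteq> Q k)}"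
    by (simp add: Dias_def suboperad_generated_def)
  have subspace: "pm.subspace (?E m)" for m
    by (rule module_hom.subspace_image[OF linear_module_hom[OF linear_extend]
          subspace_component_free_operad])
  have "?E m \<subseteq> component ?W m" for m
  proof
    fix z assume "z \<in> ?E m"
    then obtain x where x: "x \<in> component ?F m" and z: "z = extend tree_word x"
      by blast
    have "tree_word t \<in> {w \<in> {w. w \<noteq> [] \<and> set w \<subseteq> {0..\<gamma>}}. length w = m}"
      if "t \<in> Poly_Mapping.keys x" for t
      using that x set_tree_word[of \<gamma> t] length_tree_word[of \<gamma> t] leaves_pos[of \<gamma> t]
      by (auto simp: component_free_operad)
    then show "z \<in> component ?W m"
      unfolding z extend_def word_operad_def component_linear_operad mem_Collect_eq
      by (intro keys_sum_subset) auto
  qed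
  with subspace have graded: "graded_subspace ?W ?E"
    unfolding word_operad_def graded_subspace_linear_operad by blast
  have gen: "Poly_Mapping.single (tree_word t) 1 \<in> ?E (leaves t)" if "dias_tree \<gamma> t" for t
    by (rule image_eqI[of _ _ "Poly_Mapping.single t 1"])
      (use that in \<open>auto simp: component_free_operad\<close>)
  have "is_suboperad ?W ?E"
    unfolding is_suboperad_def
  proof (intro conjI allI ballI impI graded)
    show "opunit ?W \<in> ?E 1"
      using gen[of Leaf] by simp
  next
    fix m n i u v assume "u \<in> ?E m" "v \<in> ?E n" and i: "i \<in> {1..m}"
    then obtain x y where xy: "x \<in> component ?F m" "y \<in> component ?F n"
      and uv: "u = extend tree_word x" "v = extend tree_word y"
      by blast
    show "pcomp ?W m n i u v \<in> ?E (m + n - 1)"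
      unfolding uv word_operad_simps extend_tree_word_pcomp[OF xy i, symmetric]
      by (intro imageI pcomp_free_operad_closed xy i)
  qed
  moreover have "?X k \<subseteq> ?E k" for k
    using gen[of "Node (Dashv _) [Leaf, Leaf]"] gen[of "Node (Vdash _) [Leaf, Leaf]"]
    by (auto simp: numeral_2_eq_2)
  ultimately show "component (Dias \<gamma>) n \<subseteq> ?E n"
    unfolding Dias by blast
  show "?E n \<subseteq> component (Dias \<gamma>) n"
    unfolding Dias
  proof (intro Inter_greatest, elim CollectE exE conjE)
    fix A Q assume A: "A = Q n" and Q: "is_suboperad ?W Q" and X: "\<forall>k. ?X k \<subseteq> Q k"
    have sub: "pm.subspace (Q k)" for k
      using Q unfolding is_suboperad_def word_operad_def graded_subspace_linear_operad by blast
    have pcomp: "Poly_Mapping.single (word_comp i u v) 1 \<in> Q (k + l - 1)"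
      if "Poly_Mapping.single u 1 \<in> Q k" "Poly_Mapping.single v 1 \<in> Q l" "i \<in> {1..k}" for u v k l i
    proof -
      have "pcomp ?W k l i (Poly_Mapping.single u 1) (Poly_Mapping.single v 1) \<in> Q (k + l - 1)"
        using that Q unfolding is_suboperad_def by blast
      then show ?thesis by simp
    qed
    have "Poly_Mapping.single (tree_word t) 1 \<in> Q (leaves t)" if "dias_tree \<gamma> t" for t
      using that
    proof (induction rule: dias_tree_induct)
      case Leaf
      then show ?case
        using Q unfolding is_suboperad_def by simp
    next
      case (Dashv a l r)
      have "Poly_Mapping.single [0, a] 1 \<in> Q 2"
        using X[rule_format, of 2] Dashv.hyps(1) by (simp add: UN_subset_iff)
      \<comment> \<open>The node arises from the generator by composing at position 2 first, which
        leaves position 1 in place.\<close>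
      from pcomp[OF pcomp[OF this Dashv.IH(2), of 2] Dashv.IH(1), of 1] show ?case
        using leaves_pos[OF Dashv.hyps(3)]
        by (simp add: word_comp_def add.commute cong: map_cong)
    next
      case (Vdash a l r)
      have "Poly_Mapping.single [a, 0] 1 \<in> Q 2"
        using X[rule_format, of 2] Vdash.hyps(1) by (simp add: UN_subset_iff)
      from pcomp[OF pcomp[OF this Vdash.IH(2), of 2] Vdash.IH(1), of 1] show ?case
        using leaves_pos[OF Vdash.hyps(3)]
        by (simp add: word_comp_def add.commute cong: map_cong)
    qed
    then have "Poly_Mapping.single (tree_word t) c \<in> Q n"
      if "dias_tree \<gamma> t" "leaves t = n" for t c
      using pm.subspace_scale[OF sub, of "Poly_Mapping.single (tree_word t) 1" n c] that by auto
    then show "?E n \<subseteq> A"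
      unfolding A extend_def component_free_operad by (auto intro!: pm.subspace_sum[OF sub])
  qed
qed

lemma is_operad_ideal_kernel:
  "is_operad_ideal (Free_Dias \<gamma> :: ('k::field, _) ns_operad)
     (\<lambda>n. {x \<in> component (Free_Dias \<gamma>) n. extend tree_word x = 0})"
proof -
  have "pm.subspace {x \<in> component (Free_Dias \<gamma> :: ('k, _) ns_operad) n. extend tree_word x = 0}" for n
    using subspace_component_free_operad[of "dias_gens \<gamma>" gen_arity n]
    by (auto simp: pm.subspace_def linear_zero[OF linear_extend] linear_add[OF linear_extend]
        linear_scale[OF linear_extend])
  moreover have "graded_subspace (Free_Dias \<gamma> :: ('k, _) ns_operad) Q \<longleftrightarrow>
      (\<forall>n. Q n \<subseteq> component (Free_Dias \<gamma>) n \<and> pm.subspace (Q n))" for Q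
    unfolding free_operad_def by (rule graded_subspace_linear_operad)
  ultimately show ?thesis
    unfolding is_operad_ideal_def
    by (auto simp: extend_tree_word_pcomp pcomp_free_operad_closed bilinear_simps
        simp del: One_nat_def)
qed

section \<open>The relations generate the kernel\<close>

text \<open>The sum telescopes, ending with the case \<open>a = \<gamma>\<close> of the definition;
  so the barred generators determine the original ones.\<close>

lemma sum_bdashv: "a \<le> \<gamma> \<Longrightarrow> (\<Sum>b\<in>{a..\<gamma>}. bdashv \<gamma> b) = corolla gen_arity (Dashv a)"
  by (induction a rule: inc_induct) (auto simp: bdashv_def sum.atLeast_Suc_atMost)

lemma sum_bvdash: "a \<le> \<gamma> \<Longrightarrow> (\<Sum>b\<in>{a..\<gamma>}. bvdash \<gamma> b) = corolla gen_arity (Vdash a)"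
  by (induction a rule: inc_induct) (auto simp: bvdash_def sum.atLeast_Suc_atMost)

lemma bar_relations_in_kernel:
  assumes "x \<in> (bar_relations \<gamma> :: (dias_gen ptree \<Rightarrow>\<^sub>0 'k::field) set)"
  shows "extend tree_word x = 0"
proof -
  \<comment> \<open>Setting the generators of index \<open>\<gamma> + 1\<close> to \<open>0\<close> makes every barred generator a difference.\<close>
  define D V :: "nat \<Rightarrow> dias_gen ptree \<Rightarrow>\<^sub>0 'k"
    where "D = (\<lambda>a. if a \<le> \<gamma> then corolla gen_arity (Dashv a) else 0)"
      and "V = (\<lambda>a. if a \<le> \<gamma> then corolla gen_arity (Vdash a) else 0)"
  let ?c = "\<lambda>i. bilinear_extend (graft i)"
  have bar: "bdashv \<gamma> a = D a - D (Suc a)" "bvdash \<gamma> a = V a - V (Suc a)" if "a \<le> \<gamma>" for a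
    using that by (auto simp: D_def V_def bdashv_def bvdash_def)
  have sums: "(\<Sum>b\<in>{a..\<gamma>}. bdashv \<gamma> b) = D a" "(\<Sum>b\<in>{a..\<gamma>}. bvdash \<gamma> b) = V a" if "a \<le> \<gamma>" for a
    using that by (simp_all add: D_def V_def sum_bdashv sum_bvdash)
  have word: "extend tree_word (?c i (D a) (D b)) =
        (if a \<le> \<gamma> \<and> b \<le> \<gamma> then Poly_Mapping.single (word_comp i [0, a] [0, b]) 1 else 0)"
      "extend tree_word (?c i (D a) (V b)) =
        (if a \<le> \<gamma> \<and> b \<le> \<gamma> then Poly_Mapping.single (word_comp i [0, a] [b, 0]) 1 else 0)"
      "extend tree_word (?c i (V a) (D b)) =
        (if a \<le> \<gamma> \<and> b \<le> \<gamma> then Poly_Mapping.single (word_comp i [a, 0] [0, b]) 1 else 0)"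
      "extend tree_word (?c i (V a) (V b)) =
        (if a \<le> \<gamma> \<and> b \<le> \<gamma> then Poly_Mapping.single (word_comp i [a, 0] [b, 0]) 1 else 0)"
    if "i = 1 \<or> i = 2" for i a b
    using that by (auto simp: D_def V_def corolla_def numeral_2_eq_2 word_comp_def bilinear_simps
        linear_zero[OF linear_extend])
  have word_comp: "word_comp 1 [a, b] [c, d] = [max a c, max a d, b]"
      "word_comp 2 [a, b] [c, d] = [a, max b c, max b d]" for a b c d
    by (simp_all add: word_comp_def)
  \<comment> \<open>The first call turns the sums in the relations into single corollas by
    linearity; the second expands the remaining barred generators as differences and compares words
    of length three.\<close>
  show ?thesis
    using assms unfolding bar_relations_def Let_def pcomp_free_operad
    by (auto simp: linear_sum[OF linear_bilinear_extend_left, symmetric]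
        linear_sum[OF linear_bilinear_extend_right, symmetric] sums simp del: One_nat_def;
      auto simp: bar linear_diff[OF linear_extend] bilinear_simps(1,2) word word_comp
        max_absorb1 max_absorb2 simp del: One_nat_def)
qed

lemma bdashv_mem_component: "a \<in> {1..\<gamma>} \<Longrightarrow> bdashv \<gamma> a \<in> component (Free_Dias \<gamma>) 2"
  unfolding bdashv_def corolla_def component_free_operad
  by (auto dest!: subsetD[OF keys_diff] simp: numeral_2_eq_2 split: if_splits)

lemma bvdash_mem_component: "a \<in> {1..\<gamma>} \<Longrightarrow> bvdash \<gamma> a \<in> component (Free_Dias \<gamma>) 2"
  unfolding bvdash_def corolla_def component_free_operad
  by (auto dest!: subsetD[OF keys_diff] simp: numeral_2_eq_2 split: if_splits)

lemma bar_relations_subset_component: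
  "bar_relations \<gamma> \<subseteq> component (Free_Dias \<gamma> :: ('k::field, _) ns_operad) 3"
proof -
  have comp: "bilinear_extend (graft i) x y \<in> component (Free_Dias \<gamma>) 3"
    if "x \<in> component (Free_Dias \<gamma>) 2" "y \<in> component (Free_Dias \<gamma>) 2" "i \<in> {1..2}"
    for i and x y :: "dias_gen ptree \<Rightarrow>\<^sub>0 'k"
    using pcomp_free_operad_closed[OF that] by simp
  show ?thesis
    unfolding bar_relations_def Let_def pcomp_free_operad
    by (auto intro!: comp bdashv_mem_component bvdash_mem_component
        pm.subspace_diff[OF subspace_component_free_operad]
        pm.subspace_sum[OF subspace_component_free_operad])
qed

text \<open>
  Four of the five families of relations have this shape, with \<open>X\<close> and \<open>Y\<close> two compositions of
  barred generators.
\<close>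

lemma triangular_relations:
  fixes X Y :: "nat \<Rightarrow> nat \<Rightarrow> ('b \<Rightarrow>\<^sub>0 'k::field)"
  assumes I: "pm.subspace I"
    and lower: "\<And>a b. 1 \<le> a \<Longrightarrow> a < b \<Longrightarrow> b \<le> \<gamma> \<Longrightarrow> X b a \<in> I"
    and upper: "\<And>a b. 1 \<le> a \<Longrightarrow> a < b \<Longrightarrow> b \<le> \<gamma> \<Longrightarrow> X a b - Y a b \<in> I"
    and diag: "\<And>a. 1 \<le> a \<Longrightarrow> a \<le> \<gamma> \<Longrightarrow> X a a - (\<Sum>b\<in>{a..\<gamma>}. Y b a) \<in> I"
    and ab: "a \<in> {1..\<gamma>}" "b \<in> {1..\<gamma>}"
  shows "(\<Sum>i\<in>{a..\<gamma>}. \<Sum>j\<in>{b..\<gamma>}. X i j) - (\<Sum>i\<in>{a..\<gamma>}. \<Sum>j\<in>{max a b..\<gamma>}. Y i j) \<in> I"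
proof -
  \<comment> \<open>Modulo \<open>I\<close> the entry \<open>X i j\<close> is congruent to
    \<open>Z i j\<close>: it vanishes for \<open>i > j\<close>, equals \<open>Y i j\<close> for
    \<open>i < j\<close>, and becomes a column sum on the diagonal.\<close>
  define Z where "Z i j = (if i < j then Y i j else if i = j then \<Sum>k\<in>{i..\<gamma>}. Y k i else 0)" for i j
  have "X i j - Z i j \<in> I" if "i \<in> {a..\<gamma>}" "j \<in> {b..\<gamma>}" for i j
    using that ab lower upper diag by (auto simp: Z_def)
  then have "(\<Sum>i\<in>{a..\<gamma>}. \<Sum>j\<in>{b..\<gamma>}. X i j - Z i j) \<in> I"
    by (intro pm.subspace_sum[OF I])
  moreover have "(\<Sum>i\<in>{a..\<gamma>}. \<Sum>j\<in>{b..\<gamma>}. Z i j) = (\<Sum>i\<in>{a..\<gamma>}. \<Sum>j\<in>{max a b..\<gamma>}. Y i j)"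
  proof -
    \<comment> \<open>In column \<open>j\<close> the entries with \<open>i < j\<close> give their
      own \<open>Y i j\<close>, and the diagonal entry supplies all those with
      \<open>i \<ge> j\<close>. The diagonal is in range exactly if \<open>a \<le> j\<close>, which
      together with \<open>b \<le> j\<close> produces the bound \<open>max a b\<close>.\<close>
    have col: "(\<Sum>i\<in>{a..\<gamma>}. Z i j) = (if a \<le> j then \<Sum>i\<in>{a..\<gamma>}. Y i j else 0)" if "j \<le> \<gamma>" for j
    proof (cases "a \<le> j")
      case True
      have split: "(\<Sum>i\<in>{a..\<gamma>}. f i) = (\<Sum>i\<in>{a..<j}. f i) + (\<Sum>i\<in>{j..\<gamma>}. f i)"
        for f :: "nat \<Rightarrow> ('b \<Rightarrow>\<^sub>0 'k)"
        using True that by (subst sum.union_disjoint[symmetric]) (auto intro: sum.cong)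
      have "(\<Sum>i\<in>{j..\<gamma>}. Z i j) = (\<Sum>i\<in>{j}. Z i j)"
        using that by (intro sum.mono_neutral_right) (auto simp: Z_def)
      then show ?thesis
        using True unfolding split by (simp add: Z_def)
    qed (auto simp: Z_def intro!: sum.neutral)
    have "(\<Sum>i\<in>{a..\<gamma>}. \<Sum>j\<in>{b..\<gamma>}. Z i j) = (\<Sum>j\<in>{b..\<gamma>}. if a \<le> j then \<Sum>i\<in>{a..\<gamma>}. Y i j else 0)"
      by (subst sum.swap) (simp add: col)
    also have "\<dots> = (\<Sum>j\<in>{max a b..\<gamma>}. \<Sum>i\<in>{a..\<gamma>}. Y i j)"
      by (rule sum.mono_neutral_cong_right) auto
    also have "\<dots> = (\<Sum>i\<in>{a..\<gamma>}. \<Sum>j\<in>{max a b..\<gamma>}. Y i j)"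
      by (rule sum.swap)
    finally show ?thesis .
  qed
  ultimately show ?thesis
    by (simp add: sum_subtractf)
qed

section \<open>Combs and normal trees\<close>

definition right_comb :: "dias_gen ptree \<Rightarrow> nat list \<Rightarrow> dias_gen ptree" where
  "right_comb = foldl (\<lambda>t a. Node (Dashv a) [t, Leaf])"

text \<open>Left and right refer to the side of \<open>t\<close> on which the new leaves stand. The
  first letter is outermost here and innermost in \<open>right_comb\<close>, so that in both cases
  the letters follow the leaves from left to right.\<close>

definition left_comb :: "nat list \<Rightarrow> dias_gen ptree \<Rightarrow> dias_gen ptree" where
  "left_comb = foldr (\<lambda>a t. Node (Vdash a) [Leaf, t])"

lemma right_comb_simps [simp]:
  "right_comb t [] = t"
  "right_comb t (a # as) = right_comb (Node (Dashv a) [t, Leaf]) as"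
  "right_comb t (as @ bs) = right_comb (right_comb t as) bs"
  by (simp_all add: right_comb_def)

lemma left_comb_simps [simp]:
  "left_comb [] t = t"
  "left_comb (a # as) t = Node (Vdash a) [Leaf, left_comb as t]"
  "left_comb (as @ bs) t = left_comb as (left_comb bs t)"
  by (simp_all add: left_comb_def)

text \<open>The split is at the first 0, the only one in the word of a tree over the generators. As
  a function of the word alone it gives trees with equal words the same normal form and can be
  extended linearly.\<close>

definition normal_tree :: "nat list \<Rightarrow> dias_gen ptree" where
  "normal_tree w = left_comb (takeWhile (\<lambda>a. a \<noteq> 0) w)
     (right_comb Leaf (tl (dropWhile (\<lambda>a. a \<noteq> 0) w)))"

lemma normal_tree_eq:
  "0 \<notin> set u \<Longrightarrow> normal_tree (u @ 0 # v) = left_comb u (right_comb Leaf v)"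
  by (simp add: normal_tree_def takeWhile_append dropWhile_append)

text \<open>\<open>J\<close> stands for any ideal containing the relations; what is shown to lie in
  every such \<open>J\<close> lies in their intersection, the generated ideal.\<close>

locale dias_ideal =
  fixes \<gamma> :: nat and J :: "nat \<Rightarrow> (dias_gen ptree \<Rightarrow>\<^sub>0 'k::field) set"
  assumes ideal: "is_operad_ideal (Free_Dias \<gamma>) J"
    and relations: "bar_relations \<gamma> \<subseteq> J 3"
begin

section \<open>Congruence of trees modulo the ideal\<close>

lemma subspace_J: "pm.subspace (J n)"
  using ideal unfolding is_operad_ideal_def free_operad_def graded_subspace_linear_operad by blast

text \<open>Rewriting of single trees replaces computing in the quotient; well-labelledness and
  equal arity are recorded so that both sides can be grafted at the same leaves.\<close>

definition tree_cong :: "dias_gen ptree \<Rightarrow> dias_gen ptree \<Rightarrow> bool"  (infix "\<approx>" 50) where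
  "s \<approx> t \<longleftrightarrow> dias_tree \<gamma> s \<and> dias_tree \<gamma> t \<and> leaves s = leaves t \<and>
     Poly_Mapping.single s 1 - Poly_Mapping.single t 1 \<in> J (leaves s)"

lemma cong_refl: "dias_tree \<gamma> t \<Longrightarrow> t \<approx> t"
  by (simp add: tree_cong_def pm.subspace_0[OF subspace_J])

lemma cong_trans [trans]: "s \<approx> t \<Longrightarrow> t \<approx> u \<Longrightarrow> s \<approx> u"
  using pm.subspace_add[OF subspace_J, of "Poly_Mapping.single s 1 - Poly_Mapping.single t 1" "leaves s"
      "Poly_Mapping.single t 1 - Poly_Mapping.single u 1"]
  by (auto simp: tree_cong_def)

lemma cong_graft_left:
  assumes "s \<approx> t" "dias_tree \<gamma> u" "i \<in> {1..leaves s}"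
  shows "graft i s u \<approx> graft i t u"
proof -
  let ?x = "Poly_Mapping.single s 1 - Poly_Mapping.single t (1 :: 'k)"
  have "?x \<in> J (leaves s)" "Poly_Mapping.single u 1 \<in> component (Free_Dias \<gamma>) (leaves u)"
    using assms by (auto simp: tree_cong_def component_free_operad)
  then have "bilinear_extend (graft i) ?x (Poly_Mapping.single u 1) \<in> J (leaves s + leaves u - 1)"
    using ideal assms(3) unfolding is_operad_ideal_def pcomp_free_operad by blast
  then show ?thesis
    using assms by (auto simp: tree_cong_def bilinear_simps well_labelled_graft leaves_graft)
qed

lemma cong_graft_right:
  assumes "s \<approx> t" "dias_tree \<gamma> u" "i \<in> {1..leaves u}"
  shows "graft i u s \<approx> graft i u t"
proof -
  let ?x = "Poly_Mapping.single s 1 - Poly_Mapping.single t (1 :: 'k)"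
  have "?x \<in> J (leaves s)" "Poly_Mapping.single u 1 \<in> component (Free_Dias \<gamma>) (leaves u)"
    using assms by (auto simp: tree_cong_def component_free_operad)
  then have "bilinear_extend (graft i) (Poly_Mapping.single u 1) ?x \<in> J (leaves u + leaves s - 1)"
    using ideal assms(3) unfolding is_operad_ideal_def pcomp_free_operad by blast
  then show ?thesis
    using assms by (auto simp: tree_cong_def bilinear_simps well_labelled_graft leaves_graft)
qed

text \<open>The subtrees are replaced one after the other, each by grafting into a node that has a
  leaf in its place.\<close>

lemma cong_Node:
  assumes "l \<approx> l'" "r \<approx> r'" "g \<in> dias_gens \<gamma>"
  shows "Node g [l, r] \<approx> Node g [l', r']"
proof -
  have g: "gen_arity g = 2"
    by (cases g) simp_all
  have t: "dias_tree \<gamma> l" "dias_tree \<gamma> l'" "dias_tree \<gamma> r" "dias_tree \<gamma> r'"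
    using assms by (auto simp: tree_cong_def)
  have "Node g [Leaf, r] \<approx> Node g [Leaf, r']"
    using cong_graft_right[OF assms(2), of "Node g [Leaf, Leaf]" 2] assms(3) g by simp
  from cong_graft_left[OF this t(1), of 1] have "Node g [l, r] \<approx> Node g [l, r']"
    by simp
  also have "Node g [l, r'] \<approx> Node g [l', r']"
    using cong_graft_right[OF assms(1), of "Node g [Leaf, r']" 1] assms(3) g t by simp
  finally show ?thesis .
qed

text \<open>Substitutes trees for the three leaves of an arity-3 relation; going from the last leaf
  to the first keeps the indices of those still to be filled.\<close>

lemma cong_graft3:
  assumes "s \<approx> t" "leaves s = 3" "dias_tree \<gamma> x" "dias_tree \<gamma> y" "dias_tree \<gamma> z"
  shows "graft 1 (graft 2 (graft 3 s z) y) x \<approx> graft 1 (graft 2 (graft 3 t z) y) x"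
  using assms by (intro cong_graft_left) (auto simp: leaves_graft)

section \<open>From the barred relations to relations between trees\<close>

lemma bar_relations_in_J:
  fixes L R c1 c2
  defines "L \<equiv> bdashv \<gamma>" and "R \<equiv> bvdash \<gamma>"
    and "c1 \<equiv> bilinear_extend (graft 1)" and "c2 \<equiv> bilinear_extend (graft 2)"
  shows "a \<in> {1..\<gamma>} \<Longrightarrow> b \<in> {1..\<gamma>} \<Longrightarrow> c1 (L a) (R b) - c2 (R b) (L a) \<in> J 3"
    and "1 \<le> a \<Longrightarrow> a < b \<Longrightarrow> b \<le> \<gamma> \<Longrightarrow>
      {c1 (R b) (R a), c2 (L b) (L a), c1 (R b) (L a), c2 (L b) (R a),
       c1 (R a) (R b) - c2 (R b) (R a), c1 (L b) (L a) - c2 (L a) (L b),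
       c1 (R a) (L b) - c2 (R a) (R b), c1 (L a) (L b) - c2 (L a) (R b)} \<subseteq> J 3"
    and "1 \<le> a \<Longrightarrow> a \<le> \<gamma> \<Longrightarrow>
      {c1 (R a) (R a) - (\<Sum>b\<in>{a..\<gamma>}. c2 (R a) (R b)),
       (\<Sum>b\<in>{a..\<gamma>}. c1 (L a) (L b)) - c2 (L a) (L a),
       c1 (R a) (L a) - (\<Sum>b\<in>{a..\<gamma>}. c2 (R b) (R a)),
       (\<Sum>b\<in>{a..\<gamma>}. c1 (L b) (L a)) - c2 (L a) (R a)} \<subseteq> J 3"
  using relations unfolding bar_relations_def Let_def pcomp_free_operad assms
  by (simp_all add: UN_subset_iff)

lemma J_diff_commute: "x - y \<in> J n \<Longrightarrow> y - x \<in> J n"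
  using pm.subspace_neg[OF subspace_J, of "x - y" n] by simp

text \<open>Every generator is a sum of barred ones, so each composite expands into a double sum.
  The first family matches termwise; the others are instances of
  \<open>triangular_relations\<close>, whose bound \<open>max a b\<close> becomes an index on the
  other side.\<close>

lemma corolla_relations:
  fixes a b
  defines "L \<equiv> \<lambda>a. corolla gen_arity (Dashv a)" and "R \<equiv> \<lambda>a. corolla gen_arity (Vdash a)"
    and "c1 \<equiv> bilinear_extend (graft 1)" and "c2 \<equiv> bilinear_extend (graft 2)"
  assumes ab: "a \<in> {1..\<gamma>}" "b \<in> {1..\<gamma>}"
  shows "c1 (L a) (R b) - c2 (R b) (L a) \<in> J 3"
    and "c2 (L a) (L b) - c1 (L (max a b)) (L a) \<in> J 3"
    and "c2 (L a) (R b) - c1 (L a) (L (max a b)) \<in> J 3"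
    and "c1 (R a) (R b) - c2 (R (max a b)) (R a) \<in> J 3"
    and "c1 (R a) (L b) - c2 (R a) (R (max a b)) \<in> J 3"
proof -
  have L: "L k = (\<Sum>i\<in>{k..\<gamma>}. bdashv \<gamma> i)" and R: "R k = (\<Sum>i\<in>{k..\<gamma>}. bvdash \<gamma> i)"
    if "k \<le> \<gamma>" for k
    using that by (simp_all add: L_def R_def sum_bdashv sum_bvdash)
  have le: "a \<le> \<gamma>" "b \<le> \<gamma>" "max a b \<le> \<gamma>"
    using ab by auto
  note expand = le[THEN L] le[THEN R] c1_def c2_def
  have double: "bilinear_extend c (\<Sum>i\<in>A. f i) (\<Sum>j\<in>B. g j) = (\<Sum>i\<in>A. \<Sum>j\<in>B. bilinear_extend c (f i) (g j))"
    for c :: "dias_gen ptree \<Rightarrow> dias_gen ptree \<Rightarrow> dias_gen ptree"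
      and f g :: "nat \<Rightarrow> dias_gen ptree \<Rightarrow>\<^sub>0 'k" and A B
    by (subst bilinear_simps(3)) (simp only: bilinear_simps(4))
  \<comment> \<open>The same expansion with the index of the second factor outside, for composites
    whose factors carry the indices in exchanged order.\<close>
  have double': "bilinear_extend c (\<Sum>j\<in>B. g j) (\<Sum>i\<in>A. f i) = (\<Sum>i\<in>A. \<Sum>j\<in>B. bilinear_extend c (g j) (f i))"
    for c :: "dias_gen ptree \<Rightarrow> dias_gen ptree \<Rightarrow> dias_gen ptree"
      and f g :: "nat \<Rightarrow> dias_gen ptree \<Rightarrow>\<^sub>0 'k" and A B
    unfolding double by (rule sum.swap)
  note rels = bar_relations_in_J(2,3)[folded c1_def c2_def, unfolded insert_subset]
  have "(\<Sum>i\<in>{a..\<gamma>}. \<Sum>j\<in>{b..\<gamma>}. c1 (bdashv \<gamma> i) (bvdash \<gamma> j) - c2 (bvdash \<gamma> j) (bdashv \<gamma> i)) \<in> J 3"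
    using ab by (intro pm.subspace_sum[OF subspace_J] bar_relations_in_J(1)[folded c1_def c2_def]) auto
  then show "c1 (L a) (R b) - c2 (R b) (L a) \<in> J 3"
    unfolding expand by (subst double, subst double') (simp add: sum_subtractf)
  \<comment> \<open>The matching barred differences are listed with the opposite sign, hence
    \<open>J_diff_commute\<close>.\<close>
  have "(\<Sum>i\<in>{a..\<gamma>}. \<Sum>j\<in>{b..\<gamma>}. c2 (bdashv \<gamma> i) (bdashv \<gamma> j)) -
      (\<Sum>i\<in>{a..\<gamma>}. \<Sum>j\<in>{max a b..\<gamma>}. c1 (bdashv \<gamma> j) (bdashv \<gamma> i)) \<in> J 3"
    using rels by (intro triangular_relations[OF subspace_J _ _ _ ab]) (auto intro: J_diff_commute)
  then show "c2 (L a) (L b) - c1 (L (max a b)) (L a) \<in> J 3"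
    unfolding expand by (subst double, subst double')
  have "(\<Sum>i\<in>{a..\<gamma>}. \<Sum>j\<in>{b..\<gamma>}. c2 (bdashv \<gamma> i) (bvdash \<gamma> j)) -
      (\<Sum>i\<in>{a..\<gamma>}. \<Sum>j\<in>{max a b..\<gamma>}. c1 (bdashv \<gamma> i) (bdashv \<gamma> j)) \<in> J 3"
    using rels by (intro triangular_relations[OF subspace_J _ _ _ ab]) (auto intro: J_diff_commute)
  then show "c2 (L a) (R b) - c1 (L a) (L (max a b)) \<in> J 3"
    unfolding expand double .
  have "(\<Sum>i\<in>{a..\<gamma>}. \<Sum>j\<in>{b..\<gamma>}. c1 (bvdash \<gamma> i) (bvdash \<gamma> j)) -
      (\<Sum>i\<in>{a..\<gamma>}. \<Sum>j\<in>{max a b..\<gamma>}. c2 (bvdash \<gamma> j) (bvdash \<gamma> i)) \<in> J 3"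
    using rels by (intro triangular_relations[OF subspace_J _ _ _ ab]) (auto intro: J_diff_commute)
  then show "c1 (R a) (R b) - c2 (R (max a b)) (R a) \<in> J 3"
    unfolding expand by (subst double, subst double')
  have "(\<Sum>i\<in>{a..\<gamma>}. \<Sum>j\<in>{b..\<gamma>}. c1 (bvdash \<gamma> i) (bdashv \<gamma> j)) -
      (\<Sum>i\<in>{a..\<gamma>}. \<Sum>j\<in>{max a b..\<gamma>}. c2 (bvdash \<gamma> i) (bvdash \<gamma> j)) \<in> J 3"
    using rels by (intro triangular_relations[OF subspace_J _ _ _ ab]) (auto intro: J_diff_commute)
  then show "c1 (R a) (L b) - c2 (R a) (R (max a b)) \<in> J 3"
    unfolding expand double .
qed

lemma cong_corollas:
  assumes ab: "a \<in> {1..\<gamma>}" "b \<in> {1..\<gamma>}"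
  shows "Node (Dashv a) [Node (Vdash b) [Leaf, Leaf], Leaf] \<approx>
      Node (Vdash b) [Leaf, Node (Dashv a) [Leaf, Leaf]]"
    and "Node (Dashv a) [Leaf, Node (Dashv b) [Leaf, Leaf]] \<approx>
      Node (Dashv (max a b)) [Node (Dashv a) [Leaf, Leaf], Leaf]"
    and "Node (Dashv a) [Leaf, Node (Vdash b) [Leaf, Leaf]] \<approx>
      Node (Dashv a) [Node (Dashv (max a b)) [Leaf, Leaf], Leaf]"
    and "Node (Vdash a) [Node (Vdash b) [Leaf, Leaf], Leaf] \<approx>
      Node (Vdash (max a b)) [Leaf, Node (Vdash a) [Leaf, Leaf]]"
    and "Node (Vdash a) [Node (Dashv b) [Leaf, Leaf], Leaf] \<approx>
      Node (Vdash a) [Leaf, Node (Vdash (max a b)) [Leaf, Leaf]]"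
  using corolla_relations[OF ab] ab
  by (auto simp: tree_cong_def corolla_def numeral_2_eq_2 numeral_3_eq_3)

lemma cong_rotations:
  assumes ab: "a \<in> {1..\<gamma>}" "b \<in> {1..\<gamma>}"
    and trees: "dias_tree \<gamma> x" "dias_tree \<gamma> y" "dias_tree \<gamma> z"
  shows "Node (Dashv a) [Node (Vdash b) [x, y], z] \<approx> Node (Vdash b) [x, Node (Dashv a) [y, z]]"
    and "Node (Dashv a) [x, Node (Dashv b) [y, z]] \<approx>
      Node (Dashv (max a b)) [Node (Dashv a) [x, y], z]"
    and "Node (Dashv a) [x, Node (Vdash b) [y, z]] \<approx>
      Node (Dashv a) [Node (Dashv (max a b)) [x, y], z]"
    and "Node (Vdash a) [Node (Vdash b) [x, y], z] \<approx>
      Node (Vdash (max a b)) [x, Node (Vdash a) [y, z]]"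
    and "Node (Vdash a) [Node (Dashv b) [x, y], z] \<approx>
      Node (Vdash a) [x, Node (Vdash (max a b)) [y, z]]"
  using cong_corollas[OF ab, THEN cong_graft3, OF _ trees] by simp_all

section \<open>Rewriting trees into normal form\<close>

lemma dias_tree_right_comb:
  "dias_tree \<gamma> t \<Longrightarrow> set as \<subseteq> {1..\<gamma>} \<Longrightarrow> dias_tree \<gamma> (right_comb t as)"
  by (induction as arbitrary: t) auto

lemma dias_tree_left_comb:
  "dias_tree \<gamma> t \<Longrightarrow> set as \<subseteq> {1..\<gamma>} \<Longrightarrow> dias_tree \<gamma> (left_comb as t)"
  by (induction as) auto

lemma cong_right_comb: "s \<approx> t \<Longrightarrow> set as \<subseteq> {1..\<gamma>} \<Longrightarrow> right_comb s as \<approx> right_comb t as"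
proof (induction as arbitrary: s t)
  case (Cons a as)
  then show ?case
    by (auto intro!: Cons.IH cong_Node cong_refl)
qed simp

lemma cong_left_comb: "s \<approx> t \<Longrightarrow> set as \<subseteq> {1..\<gamma>} \<Longrightarrow> left_comb as s \<approx> left_comb as t"
  by (induction as) (auto intro!: cong_Node cong_refl)

lemma map_max_tree_word:
  "dias_tree \<gamma> t \<Longrightarrow> a \<in> {1..\<gamma>} \<Longrightarrow> set (map (max a) (tree_word t)) \<subseteq> {1..\<gamma>}"
  using set_tree_word[of \<gamma> t] by auto

lemma map_max_map_max: "map (max a) (map (max b) w) = map (max (max a b)) (w :: nat list)"
  by (simp add: max.assoc)

text \<open>A rotation at the root of \<open>t\<close> splits the claim into those for its two
  subtrees. The index \<open>max a b\<close> falls on the subtree whose letters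
  \<open>tree_word\<close> raises by \<open>b\<close>, so the letters agree. The induction
  generalizes over \<open>s\<close> and \<open>a\<close>, as both change.\<close>

lemma Dashv_cong_right_comb:
  assumes "dias_tree \<gamma> t" "dias_tree \<gamma> s" "a \<in> {1..\<gamma>}"
  shows "Node (Dashv a) [s, t] \<approx> right_comb s (map (max a) (tree_word t))"
  using assms
proof (induction arbitrary: s a rule: dias_tree_induct)
  case Leaf
  then show ?case
    by (auto intro!: cong_refl)
next
  case (Dashv b l r)
  have m: "max a b \<in> {1..\<gamma>}"
    using Dashv by auto
  have "Node (Dashv a) [s, Node (Dashv b) [l, r]] \<approx> Node (Dashv (max a b)) [Node (Dashv a) [s, l], r]"
    using Dashv by (intro cong_rotations)
  also have "\<dots> \<approx> right_comb (Node (Dashv a) [s, l]) (map (max (max a b)) (tree_word r))"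
    using Dashv m by (intro Dashv.IH) auto
  also have "\<dots> \<approx> right_comb (right_comb s (map (max a) (tree_word l))) (map (max (max a b)) (tree_word r))"
    using Dashv m by (intro cong_right_comb Dashv.IH map_max_tree_word)
  finally show ?case
    by (simp only: tree_word.simps map_append map_max_map_max right_comb_simps)
next
  case (Vdash b l r)
  have m: "max a b \<in> {1..\<gamma>}"
    using Vdash by auto
  have "Node (Dashv a) [s, Node (Vdash b) [l, r]] \<approx> Node (Dashv a) [Node (Dashv (max a b)) [s, l], r]"
    using Vdash by (intro cong_rotations)
  also have "\<dots> \<approx> right_comb (Node (Dashv (max a b)) [s, l]) (map (max a) (tree_word r))"
    using Vdash m by (intro Vdash.IH) auto
  also have "\<dots> \<approx> right_comb (right_comb s (map (max (max a b)) (tree_word l))) (map (max a) (tree_word r))"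
    using Vdash m by (intro cong_right_comb Vdash.IH map_max_tree_word)
  finally show ?case
    by (simp only: tree_word.simps map_append map_max_map_max right_comb_simps)
qed

text \<open>Mirror image of the preceding induction, using the last two rotations.\<close>

lemma Vdash_cong_left_comb:
  assumes "dias_tree \<gamma> t" "dias_tree \<gamma> s" "a \<in> {1..\<gamma>}"
  shows "Node (Vdash a) [t, s] \<approx> left_comb (map (max a) (tree_word t)) s"
  using assms
proof (induction arbitrary: s a rule: dias_tree_induct)
  case Leaf
  then show ?case
    by (auto intro!: cong_refl)
next
  case (Dashv b l r)
  have m: "max a b \<in> {1..\<gamma>}"
    using Dashv by auto
  have "Node (Vdash a) [Node (Dashv b) [l, r], s] \<approx> Node (Vdash a) [l, Node (Vdash (max a b)) [r, s]]"
    using Dashv by (intro cong_rotations)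
  also have "\<dots> \<approx> left_comb (map (max a) (tree_word l)) (Node (Vdash (max a b)) [r, s])"
    using Dashv m by (intro Dashv.IH) auto
  also have "\<dots> \<approx> left_comb (map (max a) (tree_word l)) (left_comb (map (max (max a b)) (tree_word r)) s)"
    using Dashv m by (intro cong_left_comb Dashv.IH map_max_tree_word)
  finally show ?case
    by (simp only: tree_word.simps map_append map_max_map_max left_comb_simps)
next
  case (Vdash b l r)
  have m: "max a b \<in> {1..\<gamma>}"
    using Vdash by auto
  have "Node (Vdash a) [Node (Vdash b) [l, r], s] \<approx> Node (Vdash (max a b)) [l, Node (Vdash a) [r, s]]"
    using Vdash by (intro cong_rotations)
  also have "\<dots> \<approx> left_comb (map (max (max a b)) (tree_word l)) (Node (Vdash a) [r, s])"
    using Vdash m by (intro Vdash.IH) auto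
  also have "\<dots> \<approx> left_comb (map (max (max a b)) (tree_word l)) (left_comb (map (max a) (tree_word r)) s)"
    using Vdash m by (intro cong_left_comb Vdash.IH map_max_tree_word)
  finally show ?case
    by (simp only: tree_word.simps map_append map_max_map_max left_comb_simps)
qed

text \<open>The first rotation carries the operation inwards past one letter of \<open>u\<close> at
  a time.\<close>

lemma Dashv_left_comb_cong:
  assumes "dias_tree \<gamma> t" "set u \<subseteq> {1..\<gamma>}" "a \<in> {1..\<gamma>}"
  shows "Node (Dashv a) [left_comb u t, Leaf] \<approx> left_comb u (Node (Dashv a) [t, Leaf])"
  using assms(2)
proof (induction u)
  case Nil
  then show ?case
    using assms by (auto intro!: cong_refl)
next
  case (Cons b u)
  have "Node (Dashv a) [Node (Vdash b) [Leaf, left_comb u t], Leaf] \<approx>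
      Node (Vdash b) [Leaf, Node (Dashv a) [left_comb u t, Leaf]]"
    using Cons assms by (intro cong_rotations) (auto intro!: dias_tree_left_comb)
  also have "\<dots> \<approx> Node (Vdash b) [Leaf, left_comb u (Node (Dashv a) [t, Leaf])]"
    using Cons by (auto intro!: cong_Node cong_refl)
  finally show ?case
    by simp
qed

lemma right_comb_left_comb_cong:
  assumes "dias_tree \<gamma> t" "set u \<subseteq> {1..\<gamma>}" "set v \<subseteq> {1..\<gamma>}"
  shows "right_comb (left_comb u t) v \<approx> left_comb u (right_comb t v)"
  using assms(1,3)
proof (induction v arbitrary: t)
  case Nil
  then show ?case
    using assms by (auto intro!: cong_refl dias_tree_left_comb)
next
  case (Cons a v)
  have "right_comb (left_comb u t) (a # v) \<approx> right_comb (left_comb u (Node (Dashv a) [t, Leaf])) v"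
    using Cons.prems assms(2) by (auto intro!: cong_right_comb Dashv_left_comb_cong)
  also have "\<dots> \<approx> left_comb u (right_comb (Node (Dashv a) [t, Leaf]) v)"
    using Cons.prems by (intro Cons.IH) auto
  finally show ?case
    by simp
qed

text \<open>At \<open>Dashv a\<close> the 0 comes from the left subtree, as the letters of the right
  one are raised to at least \<open>a \<ge> 1\<close>; the right subtree unfolds into a comb that is
  carried inwards past \<open>u\<close>. At \<open>Vdash a\<close> the roles are exchanged and the
  left combs concatenate. Positivity of the letters of \<open>u\<close> and \<open>v\<close> makes
  the decomposition of the word unique.\<close>

lemma cong_normal_form:
  assumes "dias_tree \<gamma> t"
  shows "\<exists>u v. tree_word t = u @ 0 # v \<and> set u \<subseteq> {1..\<gamma>} \<and> set v \<subseteq> {1..\<gamma>} \<and>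
    t \<approx> left_comb u (right_comb Leaf v)"
  using assms
proof (induction rule: dias_tree_induct)
  case Leaf
  show ?case
    by (intro exI[of _ "[]"]) (auto intro: cong_refl)
next
  case (Dashv a l r)
  then obtain u v where uv: "tree_word l = u @ 0 # v" "set u \<subseteq> {1..\<gamma>}" "set v \<subseteq> {1..\<gamma>}"
    and l: "l \<approx> left_comb u (right_comb Leaf v)"
    by blast
  let ?w = "map (max a) (tree_word r)"
  have w: "set ?w \<subseteq> {1..\<gamma>}"
    using Dashv.hyps by (intro map_max_tree_word)
  have "Node (Dashv a) [l, r] \<approx> right_comb l ?w"
    using Dashv.hyps by (intro Dashv_cong_right_comb)
  also have "\<dots> \<approx> right_comb (left_comb u (right_comb Leaf v)) ?w"
    using l w by (rule cong_right_comb)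
  also have "\<dots> \<approx> left_comb u (right_comb (right_comb Leaf v) ?w)"
    using uv w by (intro right_comb_left_comb_cong dias_tree_right_comb) auto
  finally have "Node (Dashv a) [l, r] \<approx> left_comb u (right_comb Leaf (v @ ?w))"
    by simp
  then show ?case
    using uv w by (intro exI[of _ u] exI[of _ "v @ ?w"]) auto
next
  case (Vdash a l r)
  then obtain u v where uv: "tree_word r = u @ 0 # v" "set u \<subseteq> {1..\<gamma>}" "set v \<subseteq> {1..\<gamma>}"
    and r: "r \<approx> left_comb u (right_comb Leaf v)"
    by blast
  let ?w = "map (max a) (tree_word l)"
  have w: "set ?w \<subseteq> {1..\<gamma>}"
    using Vdash.hyps by (intro map_max_tree_word)
  have "Node (Vdash a) [l, r] \<approx> left_comb ?w r"
    using Vdash.hyps by (intro Vdash_cong_left_comb)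
  also have "\<dots> \<approx> left_comb ?w (left_comb u (right_comb Leaf v))"
    using r w by (rule cong_left_comb)
  finally have "Node (Vdash a) [l, r] \<approx> left_comb (?w @ u) (right_comb Leaf v)"
    by simp
  then show ?case
    using uv w by (intro exI[of _ "?w @ u"] exI[of _ v]) auto
qed

lemma cong_normal_tree: "dias_tree \<gamma> t \<Longrightarrow> t \<approx> normal_tree (tree_word t)"
  using cong_normal_form[of t] by (force simp: normal_tree_eq)

text \<open>Replacing every tree of \<open>x\<close> by the normal tree of its word changes
  \<open>x\<close> by an element of \<open>J\<close>; the result is a linear image of
  \<open>extend tree_word x\<close>, hence 0.\<close>

lemma kernel_subset_J:
  assumes x: "x \<in> component (Free_Dias \<gamma>) n" and kernel: "extend tree_word x = 0"
  shows "x \<in> J n"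
proof -
  let ?d = "\<lambda>t. Poly_Mapping.single t 1 - Poly_Mapping.single (normal_tree (tree_word t)) 1"
  have "(\<Sum>t\<in>Poly_Mapping.keys x. pm_scale (Poly_Mapping.lookup x t) (?d t)) \<in> J n"
  proof (intro pm.subspace_sum[OF subspace_J] pm.subspace_scale[OF subspace_J])
    fix t assume "t \<in> Poly_Mapping.keys x"
    with x show "?d t \<in> J n"
      using cong_normal_tree[of t] by (auto simp: component_free_operad tree_cong_def)
  qed
  also have "(\<Sum>t\<in>Poly_Mapping.keys x. pm_scale (Poly_Mapping.lookup x t) (?d t)) =
      extend (\<lambda>t. t) x - extend (\<lambda>t. normal_tree (tree_word t)) x"
    by (simp add: extend_def pm.scale_right_diff_distrib sum_subtractf)
  also have "extend (\<lambda>t. normal_tree (tree_word t)) x = 0"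
    by (simp add: extend_extend[symmetric] kernel linear_zero[OF linear_extend])
  finally show ?thesis
    by (simp add: extend_id)
qed

end

text \<open>The kernel is itself an ideal containing the relations, and it lies in every such ideal
  by \<open>kernel_subset_J\<close>.\<close>

lemma ideal_generated_bar_relations:
  "ideal_generated (Free_Dias \<gamma>) (\<lambda>n. if n = 3 then bar_relations \<gamma> else {}) n =
     {x \<in> component (Free_Dias \<gamma> :: ('k::field, _) ns_operad) n. extend tree_word x = 0}"
    (is "?I = ?K n")
proof (rule antisym)
  have "bar_relations \<gamma> \<subseteq> ?K 3"
    using bar_relations_in_kernel bar_relations_subset_component by blast
  with is_operad_ideal_kernel show "?I \<subseteq> ?K n"
    unfolding ideal_generated_def by (intro Inter_lower CollectI exI[of _ ?K]) auto
  show "?K n \<subseteq> ?I"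
    unfolding ideal_generated_def
  proof (intro Inter_greatest, elim CollectE exE conjE)
    fix A and J :: "nat \<Rightarrow> (dias_gen ptree \<Rightarrow>\<^sub>0 'k) set"
    assume "A = J n" "is_operad_ideal (Free_Dias \<gamma>) J"
      and R: "\<forall>k. (if k = 3 then bar_relations \<gamma> else {}) \<subseteq> J k"
    moreover have "bar_relations \<gamma> \<subseteq> J 3"
      using R[rule_format, of 3] by simp
    ultimately interpret dias_ideal \<gamma> J
      by unfold_locales
    show "?K n \<subseteq> A"
      using kernel_subset_J \<open>A = J n\<close> by blast
  qed
qed


section \<open>The barred generators\<close>

text \<open>Barred generators are corollas or differences of corollas; conversely, corollas are sums
  of barred generators by \<open>sum_bdashv\<close> and \<open>sum_bvdash\<close>.\<close>

lemma span_bar_gens: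
  "pm.span (bar_gens \<gamma>) = pm.span (corolla gen_arity ` dias_gens \<gamma> :: (_ \<Rightarrow>\<^sub>0 'k::field) set)"
proof (rule antisym; rule pm.span_minimal[OF _ pm.subspace_span]; rule subsetI)
  have base: "corolla gen_arity g \<in> pm.span (corolla gen_arity ` dias_gens \<gamma> :: (_ \<Rightarrow>\<^sub>0 'k) set)"
    if "g \<in> dias_gens \<gamma>" for g
    using that by (intro pm.span_base imageI)
  fix x :: "dias_gen ptree \<Rightarrow>\<^sub>0 'k" assume "x \<in> bar_gens \<gamma>"
  then show "x \<in> pm.span (corolla gen_arity ` dias_gens \<gamma>)"
    by (auto simp: bar_gens_def bdashv_def bvdash_def intro!: base pm.span_diff)
next
  have base: "bdashv \<gamma> a \<in> pm.span (bar_gens \<gamma> :: (_ \<Rightarrow>\<^sub>0 'k) set)"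
    "bvdash \<gamma> a \<in> pm.span (bar_gens \<gamma> :: (_ \<Rightarrow>\<^sub>0 'k) set)" if "a \<in> {1..\<gamma>}" for a
    using that by (auto simp: bar_gens_def intro!: pm.span_base)
  fix x :: "dias_gen ptree \<Rightarrow>\<^sub>0 'k" assume "x \<in> corolla gen_arity ` dias_gens \<gamma>"
  then show "x \<in> pm.span (bar_gens \<gamma>)"
    by (auto simp: dias_gens_def sum_bdashv[symmetric] sum_bvdash[symmetric]
        intro!: pm.span_sum base)
qed

text \<open>Dimension count: at most \<open>2 * \<gamma>\<close> elements span a space that contains
  \<open>2 * \<gamma>\<close> independent corollas.\<close>

lemma independent_bar_gens: "pm.independent (bar_gens \<gamma> :: (_ \<Rightarrow>\<^sub>0 'k::field) set)"
proof -
  let ?C = "corolla gen_arity ` dias_gens \<gamma> :: (dias_gen ptree \<Rightarrow>\<^sub>0 'k) set"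
  let ?B = "bar_gens \<gamma> :: (dias_gen ptree \<Rightarrow>\<^sub>0 'k) set"
  have C: "pm.independent ?C"
    using independent_singles[of "(\<lambda>g. Node g (replicate (gen_arity g) Leaf)) ` dias_gens \<gamma>"]
    by (simp add: corolla_def[abs_def] image_image)
  have "inj_on (corolla gen_arity :: _ \<Rightarrow> _ \<Rightarrow>\<^sub>0 'k) (dias_gens \<gamma>)"
    by (auto simp: inj_on_def corolla_def dest: arg_cong[of _ _ Poly_Mapping.keys])
  then have "card ?C = card (dias_gens \<gamma>)"
    by (rule card_image)
  also have "\<dots> = 2 * \<gamma>"
    unfolding dias_gens_def by (subst card_Un_disjoint) (auto simp: card_image inj_on_def)
  finally have card_C: "card ?C = 2 * \<gamma>" .
  have fin: "finite ?B"
    by (simp add: bar_gens_def)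
  have card_B: "card ?B \<le> 2 * \<gamma>"
    unfolding bar_gens_def
    using card_image_le[of "{1..\<gamma>}" "bdashv \<gamma> :: _ \<Rightarrow> _ \<Rightarrow>\<^sub>0 'k"]
      card_image_le[of "{1..\<gamma>}" "bvdash \<gamma> :: _ \<Rightarrow> _ \<Rightarrow>\<^sub>0 'k"]
    by (intro order.trans[OF card_Un_le]) simp
  \<comment> \<open>An independent subset \<open>B\<close> spanning the same space has at least
    \<open>2 * \<gamma>\<close> elements, as many as \<open>?B\<close> can have, so it exhausts
    \<open>?B\<close>.\<close>
  obtain B where B: "B \<subseteq> ?B" "pm.independent B" "?B \<subseteq> pm.span B"
    using pm.maximal_independent_subset[of ?B] by blast
  have "?C \<subseteq> pm.span B"
    using pm.span_superset[of ?C] pm.span_minimal[OF B(3)] by (auto simp: span_bar_gens)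
  then have "card ?C \<le> card B"
    using pm.independent_span_bound[OF finite_subset[OF B(1) fin] C] by blast
  then have "B = ?B"
    using card_C card_B by (intro card_subset_eq fin B) (use card_mono[OF fin B(1)] in auto)
  then show ?thesis
    using B by simp
qed

theorem proposition2p3p8:
  fixes \<gamma> :: nat
  shows "admits_presentation (Dias \<gamma> :: ('k::field_char_0, nat list \<Rightarrow>\<^sub>0 'k) ns_operad)
           (dias_gens \<gamma>) gen_arity
           (\<lambda>n. if n = 2 then bar_gens \<gamma> else {})
           (\<lambda>n. if n = 3 then bar_relations \<gamma> else {})"
proof -
  let ?F = "Free_Dias \<gamma> :: ('k, dias_gen ptree \<Rightarrow>\<^sub>0 'k) ns_operad"
  \<comment> \<open>In arities other than 2 there are neither corollas nor barred generators, so the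
    basis condition there concerns the empty set and the zero space.\<close>
  have gens: "{g \<in> dias_gens \<gamma>. gen_arity g = n} = (if n = 2 then dias_gens \<gamma> else {})" for n
    by (auto simp: gen_arity_def)
  have "Dias \<gamma> \<cong>\<^sub>o\<^sub>p quotient_operad ?F
      (ideal_generated ?F (\<lambda>n. if n = 3 then bar_relations \<gamma> else {}))"
  proof (rule isomorphic_quotient_operad[OF linear_extend[of tree_word]])
    show "opunit ?F \<in> component ?F 1"
      by (simp add: component_free_operad) (simp add: free_operad_def)
    show "extend tree_word (opunit ?F) = opunit (Dias \<gamma>)"
      by (simp add: free_operad_def)
  qed (simp_all add: component_Dias_eq_image subspace_component_free_operad
      pcomp_free_operad_closed extend_tree_word_pcomp ideal_generated_bar_relations
      del: One_nat_def, simp_all add: free_operad_def)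
  then show ?thesis
    unfolding admits_presentation_def gens
    by (auto simp: pm.independent_empty independent_bar_gens span_bar_gens
        intro: subsetD[OF bar_relations_subset_component])
qed

end
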